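(* Let $G$ be a finitely generated one ended group. Then the end depth of $G$ is linear; that is, for a finite generating set $S$ of $G$ and $X=\Gamma(G,S)$ the corresponding Cayley graph, the end depth function $V_0^X$ has linear growth, $V_0^X(r)\sim r$.
   Context: For a group $G$ with finite generating set $S$, $\Gamma(G,S)$ is the Cayley graph, regarded as a (geodesic, locally compact, connected) metric space with the word metric $d_S$ (edges of length 1). $e$ is the identity element of $G$, and for $r>0$, $B(r)$ is the closed ball of radius $r$ centred at $e$ in $X=\Gamma(G,S)$. Number of ends: for a locally compact connected metric space $X$ and compact $K\subset X$, $e(X,K)$ is the number of unbounded connected components of $X\smallsetminus K$, and $e(X)=\sup\{e(X,K)\mid K\subset X \text{ compact}\}$. A finitely generated group $G$ is one ended if $e(\Gamma(G,S))=1$ for a finite generating set $S$ (this does not depend on $S$). End depth function: let $G=\langle S\rangle$ be a finitely generated one ended group and $X=\Gamma(G,S)$. For $r>0$ let $N(r)$ be the set of all $k\in\mathbb{R}$ such that any two points of $X\smallsetminus B(k)$ can be joined by a path outside $B(r)$ (i.e. a path in $X\smallsetminus B(r)$). Then $V_0^X(r)=\inf N(r)$. Growth: for $f,g:\mathbb{R}_+\to\mathbb{R}_+$ write $f\prec g$ if there are real constants $a_1>0,a_2>0,a_3$ such that $f(x)\leqslant a_1 g(a_2x)+a_3$ for all $x\in\mathbb{R}_+$; write $f\sim g$ if $f\prec g$ and $g\prec f$. The growth rate of $f$ is its $\sim$-equivalence class, and $f$ has linear growth if $f(x)\sim x$. The end depth of $G$ is the growth rate of $V_0^X$ (the growth rate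 does not depend on the choice of the finite generating set $S$). *)

theory Defs
  imports "HOL-Analysis.Analysis" "HOL-Algebra.Generated_Groups"
begin

section \<open>Word metric\<close>

definition finite_generating_set :: "('a, 'b) monoid_scheme \<Rightarrow> 'a set \<Rightarrow> bool" where
  "finite_generating_set G S \<longleftrightarrow> finite S \<and> S \<subseteq> carrier G \<and> generate G S = carrier G"

definition word_value :: "('a, 'b) monoid_scheme \<Rightarrow> 'a list \<Rightarrow> 'a" where
  "word_value G ws = foldr (mult G) ws \<one>\<^bsub>G\<^esub>"

definition word_length :: "('a, 'b) monoid_scheme \<Rightarrow> 'a set \<Rightarrow> 'a \<Rightarrow> nat" where
  "word_length G S g =
     (LEAST n. \<exists>ws. set ws \<subseteq> S \<union> m_inv G ` S \<and> length ws = n \<and> word_value G ws = g)"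

definition word_dist :: "('a, 'b) monoid_scheme \<Rightarrow> 'a set \<Rightarrow> 'a \<Rightarrow> 'a \<Rightarrow> nat" where
  "word_dist G S g h = word_length G S (inv\<^bsub>G\<^esub> g \<otimes>\<^bsub>G\<^esub> h)"


section \<open>The Cayley graph as a metric space\<close>

text \<open>
  The Cayley graph is the simple undirected graph with an edge between \<open>g\<close> and \<open>g \<otimes> s\<close> for
  all \<open>g\<close> and all \<open>s \<in> S\<close> with \<open>s \<noteq> \<one>\<close>.  Points of its geometric realization are given by
  their barycentric coordinates: functions into \<open>[0, 1]\<close> of total mass 1, supported on a
  vertex or on an edge.
\<close>

definition cayley_edges :: "('a, 'b) monoid_scheme \<Rightarrow> 'a set \<Rightarrow> 'a set set" where
  "cayley_edges G S = {{g, g \<otimes>\<^bsub>G\<^esub> s} | g s. g \<in> carrier G \<and> s \<in> S \<and> s \<noteq> \<one>\<^bsub>G\<^esub>}"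

definition cayley_simplices :: "('a, 'b) monoid_scheme \<Rightarrow> 'a set \<Rightarrow> 'a set set" where
  "cayley_simplices G S = {{g} | g. g \<in> carrier G} \<union> cayley_edges G S"

definition cayley_points :: "('a, 'b) monoid_scheme \<Rightarrow> 'a set \<Rightarrow> ('a \<Rightarrow> real) set" where
  "cayley_points G S =
     {p. (\<forall>v. 0 \<le> p v) \<and>
         (\<exists>\<sigma>\<in>cayley_simplices G S. (\<forall>v. v \<notin> \<sigma> \<longrightarrow> p v = 0) \<and> (\<Sum>v\<in>\<sigma>. p v) = 1)}"

definition cayley_vertex :: "'a \<Rightarrow> 'a \<Rightarrow> real" where
  "cayley_vertex g = (\<lambda>v. if v = g then 1 else 0)"

definition supp :: "('a \<Rightarrow> real) \<Rightarrow> 'a set" where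
  "supp p = {v. p v \<noteq> 0}"

definition share_simplex ::
    "('a, 'b) monoid_scheme \<Rightarrow> 'a set \<Rightarrow> ('a \<Rightarrow> real) \<Rightarrow> ('a \<Rightarrow> real) \<Rightarrow> bool" where
  "share_simplex G S p q \<longleftrightarrow> (\<exists>\<sigma>\<in>cayley_simplices G S. supp p \<union> supp q \<subseteq> \<sigma>)"

text \<open>
  With edges of length 1, a point \<open>p\<close> is at distance \<open>1 - p u\<close> from an endpoint \<open>u\<close> of the
  edge carrying it.  Hence the following is the length of a shortest path from \<open>p\<close> to \<open>q\<close> that
  leaves the edge of \<open>p\<close> through the vertex \<open>u\<close> and enters the edge of \<open>q\<close> through \<open>v\<close>.
\<close>

definition route_length ::
    "('a, 'b) monoid_scheme \<Rightarrow> 'a set \<Rightarrow> ('a \<Rightarrow> real) \<Rightarrow> ('a \<Rightarrow> real) \<Rightarrow> 'a \<Rightarrow> 'a \<Rightarrow> real" where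
  "route_length G S p q u v = (1 - p u) + real (word_dist G S u v) + (1 - q v)"

text \<open>
  Points of a common edge are at distance the difference of their coordinates at either end,
  i.e. half the \<open>\<ell>\<^sup>1\<close>-distance.  The value 0 off the carrier only serves the unconditional
  axioms of \<open>Metric_space\<close>.
\<close>

definition cayley_dist ::
    "('a, 'b) monoid_scheme \<Rightarrow> 'a set \<Rightarrow> ('a \<Rightarrow> real) \<Rightarrow> ('a \<Rightarrow> real) \<Rightarrow> real" where
  "cayley_dist G S p q =
     (if p \<in> cayley_points G S \<and> q \<in> cayley_points G S then
        if share_simplex G S p q
        then (\<Sum>v\<in>supp p \<union> supp q. \<bar>p v - q v\<bar>) / 2
        else Min ((\<lambda>(u, v). route_length G S p q u v) ` (supp p \<times> supp q))
      else 0)"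


subsection \<open>Metric axioms\<close>

context
  fixes G :: "('a, 'b) monoid_scheme" (structure) and S :: "'a set"
  assumes grp: "group G" and gen: "finite_generating_set G S"
begin

interpretation group G by (rule grp)

lemma S_carrier: "S \<subseteq> carrier G"
  using gen by (simp add: finite_generating_set_def)

lemma letters_carrier: "S \<union> m_inv G ` S \<subseteq> carrier G"
  using S_carrier by auto

lemma word_value_closed: "set ws \<subseteq> carrier G \<Longrightarrow> word_value G ws \<in> carrier G"
  unfolding word_value_def by (induction ws) auto

lemma word_value_append:
  "set ws \<subseteq> carrier G \<Longrightarrow> set vs \<subseteq> carrier G \<Longrightarrow>
     word_value G (ws @ vs) = word_value G ws \<otimes> word_value G vs"
proof (induction ws)
  case Nil
  then show ?case using word_value_closed[of vs] by (simp add: word_value_def)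
next
  case (Cons a ws)
  then show ?case using word_value_closed[of vs] word_value_closed[of ws]
    by (simp add: word_value_def m_assoc)
qed

lemma word_value_rev_inv:
  "set ws \<subseteq> carrier G \<Longrightarrow> word_value G (rev (map (m_inv G) ws)) = inv (word_value G ws)"
proof (induction ws)
  case Nil
  then show ?case by (simp add: word_value_def)
next
  case (Cons a ws)
  have "word_value G (rev (map (m_inv G) (a # ws)))
      = word_value G (rev (map (m_inv G) ws)) \<otimes> word_value G [inv a]"
    using Cons by (simp del: rev_map, subst word_value_append) (auto simp: rev_map)
  also have "\<dots> = inv (word_value G ws) \<otimes> inv a"
    using Cons by (simp add: word_value_def)
  also have "\<dots> = inv (word_value G (a # ws))"
    using Cons word_value_closed[of ws] by (simp add: inv_mult_group word_value_def)
  finally show ?case .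
qed

lemma ex_word:
  assumes "g \<in> carrier G"
  shows "\<exists>ws. set ws \<subseteq> S \<union> m_inv G ` S \<and> word_value G ws = g"
proof -
  have "g \<in> generate G S" using assms gen by (simp add: finite_generating_set_def)
  then show ?thesis
  proof induction
    case one
    show ?case by (rule exI[of _ "[]"]) (simp add: word_value_def)
  next
    case (incl h)
    then show ?case using S_carrier by (intro exI[of _ "[h]"]) (auto simp: word_value_def)
  next
    case (inv h)
    then show ?case using S_carrier by (intro exI[of _ "[inv h]"]) (auto simp: word_value_def)
  next
    case (eng h1 h2)
    then obtain u v where "set u \<subseteq> S \<union> m_inv G ` S" "word_value G u = h1"
      "set v \<subseteq> S \<union> m_inv G ` S" "word_value G v = h2" by blast
    then show ?case using word_value_append[of u v] letters_carrier
      by (intro exI[of _ "u @ v"]) auto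
  qed
qed

lemma word_length_witness:
  assumes "g \<in> carrier G"
  obtains ws where "set ws \<subseteq> S \<union> m_inv G ` S" "length ws = word_length G S g" "word_value G ws = g"
proof -
  have "\<exists>n. \<exists>ws. set ws \<subseteq> S \<union> m_inv G ` S \<and> length ws = n \<and> word_value G ws = g"
    using ex_word[OF assms] by blast
  from LeastI_ex[OF this] show ?thesis
    unfolding word_length_def[symmetric] using that by blast
qed

lemma word_length_le:
  "set ws \<subseteq> S \<union> m_inv G ` S \<Longrightarrow> word_length G S (word_value G ws) \<le> length ws"
  unfolding word_length_def by (rule Least_le) blast

lemma word_length_eq_0:
  assumes "g \<in> carrier G"
  shows "word_length G S g = 0 \<longleftrightarrow> g = \<one>"
proof
  assume "word_length G S g = 0"
  moreover obtain ws where "length ws = word_length G S g" "word_value G ws = g"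
    using word_length_witness[OF assms] .
  ultimately show "g = \<one>" by (simp add: word_value_def)
next
  assume "g = \<one>"
  then show "word_length G S g = 0" using word_length_le[of "[]"] by (simp add: word_value_def)
qed

lemma word_length_mult:
  assumes "g \<in> carrier G" "h \<in> carrier G"
  shows "word_length G S (g \<otimes> h) \<le> word_length G S g + word_length G S h"
proof -
  obtain u where u: "set u \<subseteq> S \<union> m_inv G ` S" "length u = word_length G S g" "word_value G u = g"
    using word_length_witness[OF assms(1)] .
  obtain v where v: "set v \<subseteq> S \<union> m_inv G ` S" "length v = word_length G S h" "word_value G v = h"
    using word_length_witness[OF assms(2)] .
  have "word_value G (u @ v) = g \<otimes> h"
    using word_value_append[of u v] u v letters_carrier by auto
  then show ?thesis using word_length_le[of "u @ v"] u v by simp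
qed

lemma word_length_inv_le:
  assumes "g \<in> carrier G"
  shows "word_length G S (inv g) \<le> word_length G S g"
proof -
  obtain u where u: "set u \<subseteq> S \<union> m_inv G ` S" "length u = word_length G S g" "word_value G u = g"
    using word_length_witness[OF assms(1)] .
  have "word_value G (rev (map (m_inv G) u)) = inv g"
    using word_value_rev_inv[of u] u letters_carrier by auto
  moreover have "set (rev (map (m_inv G) u)) \<subseteq> S \<union> m_inv G ` S"
    using u(1) S_carrier by (auto simp: subset_iff)
  ultimately show ?thesis using word_length_le[of "rev (map (m_inv G) u)"] u by simp
qed

lemma word_dist_eq_0:
  assumes "g \<in> carrier G" "h \<in> carrier G"
  shows "word_dist G S g h = 0 \<longleftrightarrow> g = h"
proof -
  have "inv g \<otimes> h = \<one> \<longleftrightarrow> g = h"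
    using assms by (metis inv_closed inv_equality inv_inv l_inv)
  then show ?thesis using assms by (simp add: word_dist_def word_length_eq_0)
qed

lemma word_dist_commute:
  assumes "g \<in> carrier G" "h \<in> carrier G"
  shows "word_dist G S g h = word_dist G S h g"
proof -
  have "word_dist G S a b \<le> word_dist G S b a" if "a \<in> carrier G" "b \<in> carrier G" for a b
    using word_length_inv_le[of "inv b \<otimes> a"] that by (simp add: word_dist_def inv_mult_group)
  then show ?thesis using assms by (meson le_antisym)
qed

lemma word_dist_triangle:
  assumes "g \<in> carrier G" "h \<in> carrier G" "k \<in> carrier G"
  shows "word_dist G S g k \<le> word_dist G S g h + word_dist G S h k"
proof -
  have "h \<otimes> (inv h \<otimes> k) = k"
    using assms by (simp add: m_assoc[symmetric])
  then have "(inv g \<otimes> h) \<otimes> (inv h \<otimes> k) = inv g \<otimes> k"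
    using assms by (simp add: m_assoc)
  then show ?thesis using word_length_mult[of "inv g \<otimes> h" "inv h \<otimes> k"] assms
    by (simp add: word_dist_def)
qed

lemma simplex_cases:
  assumes "\<sigma> \<in> cayley_simplices G S"
  obtains g h where "\<sigma> = {g, h}" "g \<in> carrier G" "h \<in> carrier G"
    "word_dist G S g h \<le> 1" "word_dist G S h g \<le> 1"
proof -
  from assms consider (vertex) g where "\<sigma> = {g}" "g \<in> carrier G"
    | (edge) g s where "\<sigma> = {g, g \<otimes> s}" "g \<in> carrier G" "s \<in> S"
    unfolding cayley_simplices_def cayley_edges_def by blast
  then show ?thesis
  proof cases
    case vertex
    then show ?thesis using that[of g g] word_dist_eq_0[of g g] by simp
  next
    case edge
    have s: "s \<in> carrier G" using edge S_carrier by blast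
    have "word_dist G S g (g \<otimes> s) \<le> 1"
      using word_length_le[of "[s]"] edge s
      by (simp add: word_dist_def word_value_def m_assoc[symmetric])
    then show ?thesis
      using that[of g "g \<otimes> s"] edge s word_dist_commute[of g "g \<otimes> s"] by simp
  qed
qed

lemma simplex_pair: "\<sigma> \<in> cayley_simplices G S \<Longrightarrow> \<exists>g h. \<sigma> = {g, h}"
  by (elim simplex_cases) blast

lemma simplex_finite: "\<sigma> \<in> cayley_simplices G S \<Longrightarrow> finite \<sigma>"
  by (elim simplex_cases) auto

lemma simplex_dist:
  assumes "\<sigma> \<in> cayley_simplices G S" "u \<in> \<sigma>" "v \<in> \<sigma>"
  shows "word_dist G S u v \<le> 1"
  using assms(1)
proof (rule simplex_cases)
  fix g h assume "\<sigma> = {g, h}" "g \<in> carrier G" "h \<in> carrier G"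
    "word_dist G S g h \<le> 1" "word_dist G S h g \<le> 1"
  then show ?thesis using assms(2,3) word_dist_eq_0[of g g] word_dist_eq_0[of h h] by auto
qed

lemma point_carrier:
  assumes "p \<in> cayley_points G S"
  shows "supp p \<subseteq> carrier G"
proof -
  obtain \<sigma> where "\<sigma> \<in> cayley_simplices G S" "supp p \<subseteq> \<sigma>"
    using assms unfolding cayley_points_def supp_def by auto
  then show ?thesis by (elim simplex_cases) auto
qed

lemma point_nonneg: "p \<in> cayley_points G S \<Longrightarrow> 0 \<le> p v"
  unfolding cayley_points_def by auto

lemma point_simplex:
  assumes "p \<in> cayley_points G S"
  obtains \<sigma> where "\<sigma> \<in> cayley_simplices G S" "supp p \<subseteq> \<sigma>"
  using assms unfolding cayley_points_def supp_def by auto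

lemma point_finite:
  assumes "p \<in> cayley_points G S"
  shows "finite (supp p)"
proof -
  obtain \<sigma> where "\<sigma> \<in> cayley_simplices G S" "supp p \<subseteq> \<sigma>" using point_simplex[OF assms] .
  then show ?thesis using simplex_finite finite_subset by blast
qed

lemma point_sum:
  assumes "p \<in> cayley_points G S" "finite A" "supp p \<subseteq> A"
  shows "sum p A = 1"
proof -
  obtain \<sigma> where \<sigma>: "\<sigma> \<in> cayley_simplices G S" "\<forall>v. v \<notin> \<sigma> \<longrightarrow> p v = 0" "sum p \<sigma> = 1"
    using assms(1) unfolding cayley_points_def by auto
  have "sum p (supp p) = sum p \<sigma>"
    using \<sigma> simplex_finite[of \<sigma>] by (intro sum.mono_neutral_left) (auto simp: supp_def)
  moreover have "sum p (supp p) = sum p A"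
    using assms by (intro sum.mono_neutral_left) (auto simp: supp_def)
  ultimately show ?thesis using \<sigma> by simp
qed

lemma point_nonempty: "p \<in> cayley_points G S \<Longrightarrow> supp p \<noteq> {}"
  using point_sum[of p "{}"] by fastforce

lemma point_le_1:
  assumes "p \<in> cayley_points G S"
  shows "p v \<le> 1"
proof -
  have f: "finite (insert v (supp p))" using point_finite[OF assms] by simp
  have "p v \<le> sum p (insert v (supp p))"
    by (rule member_le_sum) (use f point_nonneg[OF assms] in auto)
  also have "\<dots> = 1"
    by (rule point_sum[OF assms f]) blast
  finally show ?thesis .
qed

lemma point_two:
  assumes "p \<in> cayley_points G S" "u \<in> supp p" "v \<in> supp p" "u \<noteq> v"
  shows "p u + p v = 1"
proof -
  obtain \<sigma> where \<sigma>: "\<sigma> \<in> cayley_simplices G S" "supp p \<subseteq> \<sigma>" using point_simplex[OF assms(1)] .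
  then obtain g h where "\<sigma> = {g, h}" using simplex_pair by blast
  then have "supp p = {u, v}" using \<sigma> assms by auto
  then show ?thesis using point_sum[of p "{u, v}"] assms by simp
qed


lemma cayley_dist_common:
  assumes "p \<in> cayley_points G S" "q \<in> cayley_points G S" "share_simplex G S p q"
    "u \<in> supp p \<union> supp q"
  shows "cayley_dist G S p q = \<bar>p u - q u\<bar>"
proof -
  obtain \<sigma> where \<sigma>: "\<sigma> \<in> cayley_simplices G S" "supp p \<union> supp q \<subseteq> \<sigma>"
    using assms by (auto simp: share_simplex_def)
  then obtain g h where gh: "\<sigma> = {g, h}" using simplex_pair by blast
  have d: "cayley_dist G S p q = (\<Sum>v\<in>supp p \<union> supp q. \<bar>p v - q v\<bar>) / 2"
    using assms by (simp add: cayley_dist_def)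
  have s: "sum p (supp p \<union> supp q) = 1" "sum q (supp p \<union> supp q) = 1"
    using point_sum assms point_finite by auto
  show ?thesis
  proof (cases "supp p \<union> supp q = {u}")
    case True
    then show ?thesis using d s by simp
  next
    case False
    then obtain v where v: "v \<in> supp p \<union> supp q" "u \<noteq> v"
      using assms(4) by blast
    have "supp p \<union> supp q \<subseteq> {g, h}" using \<sigma>(2) gh by simp
    then have "supp p \<union> supp q = {u, v}" using v assms(4) by blast
    with v show ?thesis using d s by auto
  qed
qed

lemma cayley_dist_noncommon:
  assumes "p \<in> cayley_points G S" "q \<in> cayley_points G S" "\<not> share_simplex G S p q"
  shows "cayley_dist G S p q = Min ((\<lambda>(u, v). route_length G S p q u v) ` (supp p \<times> supp q))"
  using assms by (simp add: cayley_dist_def)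

lemma cayley_dist_le_route:
  assumes p: "p \<in> cayley_points G S" and q: "q \<in> cayley_points G S"
    and u: "u \<in> supp p" and v: "v \<in> supp q"
  shows "cayley_dist G S p q \<le> route_length G S p q u v"
proof (cases "share_simplex G S p q")
  case True
  show ?thesis
  proof (cases "u = v")
    case True
    then show ?thesis
      using cayley_dist_common[OF p q \<open>share_simplex G S p q\<close>, of u] u point_le_1[OF p, of u] point_le_1[OF q, of u]
      by (simp add: route_length_def)
  next
    case False
    have "1 \<le> word_dist G S u v"
      using word_dist_eq_0[of u v] False u v point_carrier[OF p] point_carrier[OF q] by fastforce
    then show ?thesis
      using cayley_dist_common[OF p q \<open>share_simplex G S p q\<close>, of u] u
        point_le_1[OF p, of u] point_le_1[OF q, of u] point_le_1[OF q, of v]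
        point_nonneg[OF p, of u] point_nonneg[OF q, of u]
      by (simp add: route_length_def abs_if split: if_splits)
  qed
next
  case False
  show ?thesis unfolding cayley_dist_noncommon[OF p q False]
    using u v point_finite[OF p] point_finite[OF q] by (intro Min_le) force+
qed

lemma cayley_dist_route:
  assumes p: "p \<in> cayley_points G S" and q: "q \<in> cayley_points G S" and "\<not> share_simplex G S p q"
  obtains u v where "u \<in> supp p" "v \<in> supp q" "cayley_dist G S p q = route_length G S p q u v"
proof -
  have "Min ((\<lambda>(u, v). route_length G S p q u v) ` (supp p \<times> supp q)) \<in> (\<lambda>(u, v). route_length G S p q u v) ` (supp p \<times> supp q)"
    using point_finite[OF p] point_finite[OF q] point_nonempty[OF p] point_nonempty[OF q]
    by (intro Min_in) auto
  then show ?thesis using that cayley_dist_noncommon[OF assms] by auto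
qed

lemma share_simplex_commute: "share_simplex G S p q \<longleftrightarrow> share_simplex G S q p"
  by (simp add: share_simplex_def Un_commute)

lemma route_length_commute:
  "p \<in> cayley_points G S \<Longrightarrow> q \<in> cayley_points G S \<Longrightarrow> u \<in> supp p \<Longrightarrow> v \<in> supp q \<Longrightarrow>
     route_length G S p q u v = route_length G S q p v u"
  using word_dist_commute[of u v] point_carrier[of p] point_carrier[of q]
  by (auto simp: route_length_def)

lemma cayley_dist_commute_le:
  assumes p: "p \<in> cayley_points G S" and q: "q \<in> cayley_points G S"
  shows "cayley_dist G S p q \<le> cayley_dist G S q p"
proof (cases "share_simplex G S p q")
  case True
  obtain u where "u \<in> supp p" using point_nonempty[OF p] by blast
  then show ?thesis
    using cayley_dist_common[OF p q True, of u] cayley_dist_common[OF q p, of u] True share_simplex_commute[of p q] by simp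
next
  case False
  then obtain u v where "u \<in> supp q" "v \<in> supp p" "cayley_dist G S q p = route_length G S q p u v"
    using cayley_dist_route[OF q p] share_simplex_commute[of p q] by blast
  then show ?thesis using cayley_dist_le_route[OF p q, of v u] route_length_commute[OF p q, of v u] by simp
qed

lemma cayley_dist_commute: "cayley_dist G S p q = cayley_dist G S q p"
proof (cases "p \<in> cayley_points G S \<and> q \<in> cayley_points G S")
  case True
  then show ?thesis using cayley_dist_commute_le[of p q] cayley_dist_commute_le[of q p] by simp
qed (auto simp: cayley_dist_def)

lemma cayley_dist_nonneg: "0 \<le> cayley_dist G S p q"
proof (cases "p \<in> cayley_points G S \<and> q \<in> cayley_points G S")
  case True
  then have p: "p \<in> cayley_points G S" and q: "q \<in> cayley_points G S" by auto
  obtain w where w: "w \<in> supp p" using point_nonempty[OF p] by blast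
  show ?thesis
  proof (cases "share_simplex G S p q")
    case True
    then show ?thesis using cayley_dist_common[OF p q True, of w] w by simp
  next
    case False
    then show ?thesis
      using cayley_dist_route[OF p q False] point_le_1[OF p] point_le_1[OF q]
      by (smt (verit, best) of_nat_0_le_iff route_length_def)
  qed
qed (auto simp: cayley_dist_def)

lemma cayley_dist_eq_0:
  assumes p: "p \<in> cayley_points G S" and q: "q \<in> cayley_points G S"
  shows "cayley_dist G S p q = 0 \<longleftrightarrow> p = q"
proof
  assume 0: "cayley_dist G S p q = 0"
  show "p = q"
  proof (cases "share_simplex G S p q")
    case True
    have "p u = q u" for u
    proof (cases "u \<in> supp p \<union> supp q")
      case t: True
      then show ?thesis using cayley_dist_common[OF p q True t] 0 by simp
    qed (auto simp: supp_def)
    then show ?thesis by blast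
  next
    case False
    then obtain u v where uv: "u \<in> supp p" "v \<in> supp q" "route_length G S p q u v = 0"
      using cayley_dist_route[OF p q] 0 by metis
    then have e: "p u = 1" "q v = 1" "word_dist G S u v = 0"
      using point_le_1[OF p, of u] point_le_1[OF q, of v] by (auto simp: route_length_def)
    then have "u = v" using word_dist_eq_0 uv point_carrier[OF p] point_carrier[OF q] by blast
    have "supp p = {u}" using point_two[OF p, of u] e uv by (fastforce simp: supp_def)
    moreover have "supp q = {v}" using point_two[OF q, of v] e uv by (fastforce simp: supp_def)
    ultimately have "share_simplex G S p q" using \<open>u = v\<close> uv point_carrier[OF p]
      by (auto simp: share_simplex_def cayley_simplices_def)
    then show ?thesis using False by simp
  qed
next
  assume "p = q"
  moreover have "share_simplex G S p p" using point_simplex[OF p] unfolding share_simplex_def by (metis Un_absorb)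
  moreover obtain w where "w \<in> supp p" using point_nonempty[OF p] by blast
  ultimately show "cayley_dist G S p q = 0" using cayley_dist_common[OF p p, of w] by simp
qed

lemma exit_le:
  assumes p: "p \<in> cayley_points G S" and q: "q \<in> cayley_points G S" and c: "share_simplex G S p q"
    and v: "v \<in> supp q" and w: "w \<in> carrier G"
  shows "\<exists>u\<in>supp p. (1 - p u) + real (word_dist G S u w)
           \<le> cayley_dist G S p q + (1 - q v) + real (word_dist G S v w)"
proof (cases "v \<in> supp p")
  case True
  then show ?thesis using cayley_dist_common[OF p q c, of v] by (intro bexI[of _ v]) auto
next
  case False
  obtain u where u: "u \<in> supp p" using point_nonempty[OF p] by blast
  obtain \<sigma> where \<sigma>: "\<sigma> \<in> cayley_simplices G S" "supp p \<union> supp q \<subseteq> \<sigma>"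
    using c by (auto simp: share_simplex_def)
  then obtain g h where gh: "\<sigma> = {g, h}" using simplex_pair by blast
  have "supp p = {u}" using \<sigma> gh u v False by auto
  then have pu: "p u = 1" using point_sum[OF p, of "{u}"] by simp
  have pv: "p v = 0" using False by (simp add: supp_def)
  have d: "cayley_dist G S p q = q v"
    using cayley_dist_common[OF p q c, of v] v pv point_nonneg[OF q, of v] by simp
  have "word_dist G S u v \<le> 1" using simplex_dist[OF \<sigma>(1)] \<sigma>(2) u v by blast
  moreover have "word_dist G S u w \<le> word_dist G S u v + word_dist G S v w"
    using word_dist_triangle u v w point_carrier[OF p] point_carrier[OF q] by blast
  ultimately have "real (word_dist G S u w) \<le> 1 + real (word_dist G S v w)" by linarith
  then show ?thesis using u pu d by (intro bexI[of _ u]) auto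
qed

lemma cayley_dist_triangle_common1:
  assumes p: "p \<in> cayley_points G S" and q: "q \<in> cayley_points G S" and r: "r \<in> cayley_points G S"
    and c: "share_simplex G S p q" and nc: "\<not> share_simplex G S q r"
  shows "cayley_dist G S p r \<le> cayley_dist G S p q + cayley_dist G S q r"
proof -
  obtain v w where vw: "v \<in> supp q" "w \<in> supp r" "cayley_dist G S q r = route_length G S q r v w"
    using cayley_dist_route[OF q r nc] .
  obtain u where "u \<in> supp p" "(1 - p u) + real (word_dist G S u w)
           \<le> cayley_dist G S p q + (1 - q v) + real (word_dist G S v w)"
    using exit_le[OF p q c vw(1), of w] vw point_carrier[OF r] by blast
  then show ?thesis using cayley_dist_le_route[OF p r, of u w] vw by (simp add: route_length_def)
qed

lemma cayley_dist_triangle: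
  assumes p: "p \<in> cayley_points G S" and q: "q \<in> cayley_points G S" and r: "r \<in> cayley_points G S"
  shows "cayley_dist G S p r \<le> cayley_dist G S p q + cayley_dist G S q r"
proof -
  consider (cc) "share_simplex G S p q" "share_simplex G S q r" | (cn) "share_simplex G S p q" "\<not> share_simplex G S q r"
    | (nc) "\<not> share_simplex G S p q" "share_simplex G S q r" | (nn) "\<not> share_simplex G S p q" "\<not> share_simplex G S q r" by blast
  then show ?thesis
  proof cases
    case cc
    show ?thesis
    proof (cases "\<exists>v. supp q = {v}")
      case True
      then obtain v where v: "supp q = {v}" by blast
      then have qv: "q v = 1" using point_sum[OF q, of "{v}"] by simp
      have pv: "cayley_dist G S p q = 1 - p v"
        using cayley_dist_common[OF p q cc(1), of v] v qv point_le_1[OF p, of v] by simp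
      have vC: "v \<in> carrier G" using v point_carrier[OF q] by blast
      have rv: "cayley_dist G S q r = 1 - r v"
        using cayley_dist_common[OF q r cc(2), of v] v qv point_le_1[OF r, of v] by simp
      have 0: "word_dist G S v v = 0" using word_dist_eq_0 vC by blast
      obtain u where u: "u \<in> supp p"
        "(1 - p u) + real (word_dist G S u v) \<le> cayley_dist G S p q"
        using exit_le[OF p q cc(1), of v v] v vC qv 0 by auto
      obtain w where w: "w \<in> supp r"
        "(1 - r w) + real (word_dist G S w v) \<le> cayley_dist G S r q"
        using exit_le[OF r q _, of v v] cc(2) share_simplex_commute[of q r] v vC qv 0 by auto
      have uw: "u \<in> carrier G" "w \<in> carrier G" using u w point_carrier[OF p] point_carrier[OF r] by auto
      have "word_dist G S u w \<le> word_dist G S u v + word_dist G S w v"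
        using word_dist_triangle[of u v w] word_dist_commute[of v w] uw vC by simp
      then have "route_length G S p r u w \<le> cayley_dist G S p q + cayley_dist G S q r"
        using u w cayley_dist_commute[of q r] unfolding route_length_def by linarith
      then show ?thesis using cayley_dist_le_route[OF p r, of u w] u w by linarith
    next
      case False
      obtain \<sigma> where \<sigma>: "\<sigma> \<in> cayley_simplices G S" "supp p \<union> supp q \<subseteq> \<sigma>"
        using cc by (auto simp: share_simplex_def)
      obtain \<tau> where \<tau>: "\<tau> \<in> cayley_simplices G S" "supp q \<union> supp r \<subseteq> \<tau>"
        using cc by (auto simp: share_simplex_def)
      obtain g h where gh: "\<sigma> = {g, h}" using \<sigma> simplex_pair by blast
      obtain g' h' where gh': "\<tau> = {g', h'}" using \<tau> simplex_pair by blast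
      obtain v where v: "v \<in> supp q" using point_nonempty[OF q] by blast
      then obtain v' where v': "v' \<in> supp q" "v' \<noteq> v" using False by blast
      have e: "\<sigma> = {v, v'}" "\<tau> = {v, v'}" using gh gh' \<sigma> \<tau> v v' by auto
      then have sq: "supp q = {v, v'}" using \<sigma> v v' by auto
      have c: "share_simplex G S p r" using \<sigma> \<tau> e unfolding share_simplex_def
        by (intro bexI[of _ \<sigma>]) auto
      obtain u where u: "u \<in> supp p" using point_nonempty[OF p] by blast
      then have "u \<in> supp q" using sq e \<sigma> by auto
      then show ?thesis
        using cayley_dist_common[OF p r c, of u] cayley_dist_common[OF p q cc(1), of u] cayley_dist_common[OF q r cc(2), of u] u
        by simp
    qed
  next
    case cn
    then show ?thesis using cayley_dist_triangle_common1[OF p q r] by blast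
  next
    case nc
    then show ?thesis
      using cayley_dist_triangle_common1[OF r q p] share_simplex_commute
        cayley_dist_commute[of r p] cayley_dist_commute[of r q] cayley_dist_commute[of q p] by (simp add: add.commute)
  next
    case nn
    obtain u v where uv: "u \<in> supp p" "v \<in> supp q" "cayley_dist G S p q = route_length G S p q u v"
      using cayley_dist_route[OF p q nn(1)] .
    obtain v' w where vw: "v' \<in> supp q" "w \<in> supp r" "cayley_dist G S q r = route_length G S q r v' w"
      using cayley_dist_route[OF q r nn(2)] .
    have C: "u \<in> carrier G" "v \<in> carrier G" "v' \<in> carrier G" "w \<in> carrier G"
      using uv vw point_carrier p q r by blast+
    have "real (word_dist G S v v') \<le> (1 - q v) + (1 - q v')"
    proof (cases "v = v'")
      case True
      then show ?thesis using word_dist_eq_0[of v v] C point_le_1[OF q, of v] by simp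
    next
      case False
      obtain \<sigma> where \<sigma>: "\<sigma> \<in> cayley_simplices G S" "supp q \<subseteq> \<sigma>" using point_simplex[OF q] .
      then have "word_dist G S v v' \<le> 1" using simplex_dist[OF \<sigma>(1)] uv vw by blast
      then show ?thesis using point_two[OF q uv(2) vw(1) False] by simp
    qed
    moreover have "word_dist G S u w \<le> word_dist G S u v + word_dist G S v v' + word_dist G S v' w"
      using word_dist_triangle[of u v w] word_dist_triangle[of v v' w] C by simp
    ultimately show ?thesis
      using cayley_dist_le_route[OF p r uv(1) vw(2)] uv(3) vw(3) unfolding route_length_def by linarith
  qed
qed

lemma cayley_metric: "Metric_space (cayley_points G S) (cayley_dist G S)"
  by unfold_locales (use cayley_dist_nonneg cayley_dist_commute cayley_dist_eq_0 cayley_dist_triangle in auto)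

lemma supp_vertex: "supp (cayley_vertex g) = {g}"
  by (auto simp: supp_def cayley_vertex_def)

lemma vertex_point: "g \<in> carrier G \<Longrightarrow> cayley_vertex g \<in> cayley_points G S"
  unfolding cayley_points_def cayley_simplices_def
  by (auto simp: cayley_vertex_def intro!: bexI[of _ "{g}"])

lemma cayley_dist_vertex:
  assumes g: "g \<in> carrier G" and h: "h \<in> carrier G"
  shows "cayley_dist G S (cayley_vertex g) (cayley_vertex h) = real (word_dist G S g h)"
proof (cases "share_simplex G S (cayley_vertex g) (cayley_vertex h)")
  case True
  have vals: "cayley_vertex g g = 1" "cayley_vertex h g = (if g = h then 1 else 0)"
    by (simp_all add: cayley_vertex_def)
  have "cayley_dist G S (cayley_vertex g) (cayley_vertex h) = \<bar>cayley_vertex g g - cayley_vertex h g\<bar>"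
    by (rule cayley_dist_common[OF vertex_point[OF g] vertex_point[OF h] True]) (simp add: supp_vertex)
  then have d: "cayley_dist G S (cayley_vertex g) (cayley_vertex h) = (if g = h then 0 else 1)"
    using vals by simp
  obtain \<sigma> where \<sigma>: "\<sigma> \<in> cayley_simplices G S" "g \<in> \<sigma>" "h \<in> \<sigma>"
    using True by (auto simp: share_simplex_def supp_vertex)
  have "word_dist G S g h = (if g = h then 0 else 1)"
    using simplex_dist[OF \<sigma>] word_dist_eq_0[OF g h] by (cases "word_dist G S g h = 0") (simp, fastforce)
  then show ?thesis using d by simp
next
  case False
  obtain u v where "u \<in> supp (cayley_vertex g)" "v \<in> supp (cayley_vertex h)"
    "cayley_dist G S (cayley_vertex g) (cayley_vertex h)
       = route_length G S (cayley_vertex g) (cayley_vertex h) u v"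
    using cayley_dist_route[OF vertex_point[OF g] vertex_point[OF h] False] .
  then have "cayley_dist G S (cayley_vertex g) (cayley_vertex h)
       = route_length G S (cayley_vertex g) (cayley_vertex h) g h"
    by (simp add: supp_vertex)
  moreover have "cayley_vertex g g = 1" "cayley_vertex h h = 1"
    by (simp_all add: cayley_vertex_def)
  ultimately show ?thesis by (simp add: route_length_def)
qed

end


section \<open>Ends\<close>

definition unbounded_components :: "'x set \<Rightarrow> ('x \<Rightarrow> 'x \<Rightarrow> real) \<Rightarrow> 'x set \<Rightarrow> 'x set set" where
  "unbounded_components M d K =
     {C \<in> connected_components_of (subtopology (Metric_space.mtopology M d) (M - K)).
        \<not> Metric_space.mbounded M d C}"

definition ends_off :: "'x set \<Rightarrow> ('x \<Rightarrow> 'x \<Rightarrow> real) \<Rightarrow> 'x set \<Rightarrow> enat" where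
  "ends_off M d K =
     (if finite (unbounded_components M d K) then enat (card (unbounded_components M d K)) else \<infinity>)"

definition number_of_ends :: "'x set \<Rightarrow> ('x \<Rightarrow> 'x \<Rightarrow> real) \<Rightarrow> enat" where
  "number_of_ends M d = (SUP K \<in> {K. compactin (Metric_space.mtopology M d) K}. ends_off M d K)"

definition one_ended :: "('a, 'b) monoid_scheme \<Rightarrow> bool" where
  "one_ended G \<longleftrightarrow>
     (\<exists>S. finite_generating_set G S \<and> number_of_ends (cayley_points G S) (cayley_dist G S) = 1)"


section \<open>The end depth function\<close>

definition joined_in :: "'x set \<Rightarrow> ('x \<Rightarrow> 'x \<Rightarrow> real) \<Rightarrow> 'x set \<Rightarrow> 'x \<Rightarrow> 'x \<Rightarrow> bool" where
  "joined_in M d A x y \<longleftrightarrow>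
     (\<exists>\<gamma>. pathin (subtopology (Metric_space.mtopology M d) A) \<gamma> \<and> \<gamma> 0 = x \<and> \<gamma> 1 = y)"

definition end_depth_set :: "'x set \<Rightarrow> ('x \<Rightarrow> 'x \<Rightarrow> real) \<Rightarrow> 'x \<Rightarrow> real \<Rightarrow> real set" where
  "end_depth_set M d e r =
     {k. \<forall>x \<in> M - Metric_space.mcball M d e k. \<forall>y \<in> M - Metric_space.mcball M d e k.
           joined_in M d (M - Metric_space.mcball M d e r) x y}"

definition cayley_end_depth :: "('a, 'b) monoid_scheme \<Rightarrow> 'a set \<Rightarrow> real \<Rightarrow> real" where
  "cayley_end_depth G S r =
     Inf (end_depth_set (cayley_points G S) (cayley_dist G S) (cayley_vertex \<one>\<^bsub>G\<^esub>) r)"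


section \<open>Growth\<close>

text \<open>
  The end depth function is defined for positive radii only, so functions on \<open>\<real>\<^sub>+\<close> are compared
  on the positive reals; including 0 would only affect the additive constant.
\<close>

definition growth_le :: "(real \<Rightarrow> real) \<Rightarrow> (real \<Rightarrow> real) \<Rightarrow> bool" where
  "growth_le f g \<longleftrightarrow> (\<exists>a1>0. \<exists>a2>0. \<exists>a3. \<forall>x>0. f x \<le> a1 * g (a2 * x) + a3)"

definition growth_equiv :: "(real \<Rightarrow> real) \<Rightarrow> (real \<Rightarrow> real) \<Rightarrow> bool" where
  "growth_equiv f g \<longleftrightarrow> growth_le f g \<and> growth_le g f"

definition linear_growth :: "(real \<Rightarrow> real) \<Rightarrow> bool" where
  "linear_growth f \<longleftrightarrow> growth_equiv f (\<lambda>x. x)"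

end

theory Submission
  imports Defs
begin

text \<open>
  One-endedness says that off any finite vertex set \<open>F\<close> all but finitely many vertices of the Cayley
  graph are joined to each other.  Suppose a vertex \<open>x\<close> with \<open>\<bar>x\<bar> > 2n\<close> is not in the unbounded
  component \<open>U\<close> off the ball \<open>B\<close> of radius \<open>n\<close> about \<open>\<one>\<close>.  The finite set \<open>T\<close> of vertices outside \<open>U\<close>
  contains the translate \<open>x B\<close>, which is disjoint from \<open>B\<close>; hence the connected unbounded set \<open>U \<union> B\<close>
  avoids \<open>x B\<close> and lies in \<open>x U\<close>.  So \<open>x T \<subseteq> T - {\<one>}\<close>, which contradicts finiteness of \<open>T\<close>.
  Therefore \<open>V\<^sub>0(r) \<le> 2 r + 3\<close>, while \<open>V\<^sub>0(r) \<ge> r - 1\<close> because there are vertices of every length.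
\<close>

section \<open>Combinatorial connectivity in the Cayley graph\<close>

definition cayley_adj :: "('a, 'b) monoid_scheme \<Rightarrow> 'a set \<Rightarrow> ('a \<times> 'a) set" where
  "cayley_adj G S = {(g, g \<otimes>\<^bsub>G\<^esub> s) | g s. g \<in> carrier G \<and> s \<in> S \<union> m_inv G ` S}"

text \<open>\<open>reach G S A\<close> is reflexive also at points outside \<open>A\<close>.\<close>

definition reach :: "('a, 'b) monoid_scheme \<Rightarrow> 'a set \<Rightarrow> 'a set \<Rightarrow> ('a \<times> 'a) set" where
  "reach G S A = (cayley_adj G S \<inter> A \<times> A)\<^sup>*"

text \<open>The combinatorial form of having at most one end: no topology enters, so it can be moved
  between generating sets. A finite group satisfies it with \<open>F' = carrier G\<close>, which is
  why infiniteness of \<open>carrier G\<close> is carried separately.\<close>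

definition far_connected :: "('a, 'b) monoid_scheme \<Rightarrow> 'a set \<Rightarrow> bool" where
  "far_connected G S \<longleftrightarrow>
     (\<forall>F. finite F \<longrightarrow> (\<exists>F'. finite F' \<and>
        (\<forall>g\<in>carrier G - F'. \<forall>h\<in>carrier G - F'. (g, h) \<in> reach G S (carrier G - F))))"

lemma reach_refl [simp]: "(g, g) \<in> reach G S A"
  by (simp add: reach_def)

lemma reach_trans: "(g, h) \<in> reach G S A \<Longrightarrow> (h, k) \<in> reach G S A \<Longrightarrow> (g, k) \<in> reach G S A"
  unfolding reach_def by (rule rtrancl_trans)

lemma reach_mono: "A \<subseteq> B \<Longrightarrow> (g, h) \<in> reach G S A \<Longrightarrow> (g, h) \<in> reach G S B"
  unfolding reach_def by (erule rtrancl_mono[THEN subsetD, rotated]) blast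

lemma reach_adj: "(g, h) \<in> cayley_adj G S \<Longrightarrow> g \<in> A \<Longrightarrow> h \<in> A \<Longrightarrow> (g, h) \<in> reach G S A"
  unfolding reach_def by blast

lemma reach_in: "(g, h) \<in> reach G S A \<Longrightarrow> g \<in> A \<Longrightarrow> h \<in> A"
  unfolding reach_def by (induction rule: rtrancl_induct) auto

text \<open>Every vertex on a path from \<open>g\<close> is itself reached from \<open>g\<close>, so
  the path never leaves the component of \<open>g\<close>. This upgrades connectivity in
  \<open>A\<close> to connectivity inside a component.\<close>

lemma reach_confined:
  assumes "(g, h) \<in> reach G S A"
  shows "(g, h) \<in> reach G S {k. (g, k) \<in> reach G S A}"
  using assms unfolding reach_def[of G S A]
proof (induction rule: rtrancl_induct)
  case base
  show ?case by simp
next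
  case (step y z)
  from step.hyps(2) have "(y, z) \<in> cayley_adj G S" by blast
  moreover have "(g, z) \<in> (cayley_adj G S \<inter> A \<times> A)\<^sup>*" using step.hyps by (rule rtrancl_into_rtrancl)
  ultimately show ?case using step by (auto intro: reach_trans reach_adj)
qed

section \<open>Word length, balls and translations\<close>

locale cayley_graph = group G for G :: "('a, 'b) monoid_scheme" (structure) +
  fixes S :: "'a set"
  assumes gen: "finite_generating_set G S"
begin

abbreviation letters where "letters \<equiv> S \<union> m_inv G ` S"

abbreviation len where "len \<equiv> word_length G S"

definition vball where "vball n = {g \<in> carrier G. len g \<le> n}"

lemma letters_closed: "s \<in> letters \<Longrightarrow> s \<in> carrier G"
  using letters_carrier[OF is_group gen] by blast

lemma finite_letters: "finite letters"
  using gen by (simp add: finite_generating_set_def)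

lemma inv_letters: "s \<in> letters \<Longrightarrow> inv s \<in> letters"
  using S_carrier[OF is_group gen] by auto

lemma adj_closed: "(g, h) \<in> cayley_adj G S \<Longrightarrow> g \<in> carrier G \<and> h \<in> carrier G"
  using letters_closed by (auto simp: cayley_adj_def)

lemma adj_sym: assumes "(g, h) \<in> cayley_adj G S" shows "(h, g) \<in> cayley_adj G S"
proof -
  obtain s where s: "s \<in> letters" "g \<in> carrier G" "h = g \<otimes> s"
    using assms by (auto simp: cayley_adj_def)
  then have "g = h \<otimes> inv s" using letters_closed by (simp add: m_assoc)
  moreover have "h \<in> carrier G" using adj_closed assms by blast
  ultimately show ?thesis using inv_letters[OF s(1)] unfolding cayley_adj_def by blast
qed

lemma reach_sym: assumes "(g, h) \<in> reach G S A" shows "(h, g) \<in> reach G S A"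
proof -
  have "sym (cayley_adj G S \<inter> A \<times> A)" using adj_sym by (auto simp: sym_def)
  then show ?thesis using assms unfolding reach_def by (meson sym_rtrancl symD)
qed

lemma adj_translate:
  assumes "(g, h) \<in> cayley_adj G S" "x \<in> carrier G"
  shows "(x \<otimes> g, x \<otimes> h) \<in> cayley_adj G S"
proof -
  obtain s where s: "s \<in> letters" "g \<in> carrier G" "h = g \<otimes> s"
    using assms by (auto simp: cayley_adj_def)
  then have "x \<otimes> h = (x \<otimes> g) \<otimes> s" using letters_closed assms(2) by (simp add: m_assoc)
  then show ?thesis using s assms(2) unfolding cayley_adj_def by blast
qed

lemma reach_translate:
  assumes "(g, h) \<in> reach G S A" "x \<in> carrier G" "\<And>a. a \<in> A \<Longrightarrow> a \<in> carrier G \<Longrightarrow> x \<otimes> a \<in> B"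
  shows "(x \<otimes> g, x \<otimes> h) \<in> reach G S B"
  using assms(1) unfolding reach_def[of G S A]
proof (induction rule: rtrancl_induct)
  case base
  show ?case by simp
next
  case (step y z)
  then have yz: "(y, z) \<in> cayley_adj G S" "y \<in> A" "z \<in> A" by auto
  then have "(x \<otimes> y, x \<otimes> z) \<in> reach G S B"
    using adj_translate[OF yz(1) assms(2)] assms(3) adj_closed[OF yz(1)] by (simp add: reach_adj)
  with step.IH show ?case by (rule reach_trans)
qed

lemma len_one: "len \<one> = 0"
  using word_length_eq_0[OF is_group gen, of \<one>] by simp

lemma len_letter: "s \<in> letters \<Longrightarrow> len s \<le> 1"
  using word_length_le[OF is_group gen, of "[s]"] letters_closed[of s] by (simp add: word_value_def)

lemma len_mult: "g \<in> carrier G \<Longrightarrow> h \<in> carrier G \<Longrightarrow> len (g \<otimes> h) \<le> len g + len h"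
  by (rule word_length_mult[OF is_group gen])

lemma len_mult_ge:
  assumes "g \<in> carrier G" "h \<in> carrier G"
  shows "len g \<le> len (g \<otimes> h) + len h"
proof -
  have "len ((g \<otimes> h) \<otimes> inv h) \<le> len (g \<otimes> h) + len (inv h)" using assms by (intro len_mult) auto
  then show ?thesis using assms word_length_inv_le[OF is_group gen assms(2)] by (simp add: m_assoc)
qed

lemma finite_vball: "finite (vball n)"
proof -
  have "vball n \<subseteq> word_value G ` {ws. set ws \<subseteq> letters \<and> length ws \<le> n}"
  proof
    fix g assume "g \<in> vball n"
    then have g: "g \<in> carrier G" "len g \<le> n" by (auto simp: vball_def)
    then show "g \<in> word_value G ` {ws. set ws \<subseteq> letters \<and> length ws \<le> n}"
      using word_length_witness[OF is_group gen g(1)] by (metis (mono_tags, lifting) image_eqI mem_Collect_eq)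
  qed
  then show ?thesis using finite_lists_length_le[OF finite_letters] finite_subset by blast
qed

text \<open>Delete the last letter of a shortest word for \<open>g\<close>. The result is no shorter
  than \<open>m\<close>, since one letter changes the length by at most 1. This drives the descents
  towards \<open>\<one>\<close>.\<close>

lemma len_predecessor:
  assumes g: "g \<in> carrier G" "len g = Suc m"
  obtains h where "(h, g) \<in> cayley_adj G S" "len h = m"
proof -
  obtain ws where ws: "set ws \<subseteq> letters" "length ws = Suc m" "word_value G ws = g"
    using word_length_witness[OF is_group gen g(1)] g(2) by metis
  then obtain vs s where vs: "ws = vs @ [s]" by (metis length_Suc_conv_rev)
  define h where "h = word_value G vs"
  have sc: "set vs \<subseteq> carrier G" "s \<in> letters" "s \<in> carrier G" using ws vs letters_closed by auto
  have hc: "h \<in> carrier G" unfolding h_def using word_value_closed[OF is_group gen sc(1)] .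
  have gh: "g = h \<otimes> s"
    using word_value_append[OF is_group gen, of vs "[s]"] sc ws vs by (simp add: word_value_def h_def)
  have "len h \<le> m" using word_length_le[OF is_group gen, of vs] ws vs by (simp add: h_def)
  moreover have "Suc m \<le> len h + 1" using len_mult[OF hc sc(3)] len_letter[OF sc(2)] gh g(2) by simp
  moreover have "(h, g) \<in> cayley_adj G S" unfolding cayley_adj_def using hc gh sc by blast
  ultimately show ?thesis using that[of h] by simp
qed

lemma reach_one_vball:
  assumes "g \<in> vball n"
  shows "(\<one>, g) \<in> reach G S (vball n)"
proof -
  have "len g = m \<Longrightarrow> g \<in> vball n \<Longrightarrow> (\<one>, g) \<in> reach G S (vball n)" for m
  proof (induction m arbitrary: g)
    case 0
    then show ?case using word_length_eq_0[OF is_group gen, of g] by (auto simp: vball_def)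
  next
    case (Suc m)
    then obtain h where h: "(h, g) \<in> cayley_adj G S" "len h = m"
      using len_predecessor[of g m] by (auto simp: vball_def)
    then have "h \<in> vball n" using Suc.prems adj_closed[OF h(1)] by (auto simp: vball_def)
    then show ?case using Suc.IH[of h] h Suc.prems reach_adj[OF h(1)] by (meson reach_trans)
  qed
  then show ?thesis using assms by blast
qed

lemma reach_one: "g \<in> carrier G \<Longrightarrow> (\<one>, g) \<in> reach G S (carrier G)"
  by (rule reach_mono[OF _ reach_one_vball[of g "len g"]]) (auto simp: vball_def)

text \<open>Finite balls cannot exhaust an infinite group, so some element has length at least
  \<open>n\<close>; passing to predecessors lowers the length by exactly 1 and so hits
  \<open>n\<close>.\<close>

lemma ex_len:
  assumes "infinite (carrier G)"
  obtains g where "g \<in> carrier G" "len g = n"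
proof -
  have "\<exists>g\<in>carrier G. len g \<ge> n"
    using assms finite_subset[OF _ finite_vball[of n], of "carrier G"] by (force simp: vball_def)
  then obtain g m where g: "g \<in> carrier G" "len g = m" "n \<le> m" by blast
  have "g \<in> carrier G \<Longrightarrow> len g = m \<Longrightarrow> \<exists>g\<in>carrier G. len g = n"
    using \<open>n \<le> m\<close>
  proof (induction m arbitrary: g rule: dec_induct)
    case base
    then show ?case by blast
  next
    case (step m)
    then obtain h where "(h, g) \<in> cayley_adj G S" "len h = m"
      using len_predecessor[of g m] by metis
    then show ?case using step.IH adj_closed by blast
  qed
  then show ?thesis using g that by blast
qed

text \<open>Follow a path from \<open>\<one>\<close>, which lies in \<open>F\<close>, to
  \<open>g\<close>: after its last visit to \<open>F\<close> it is at a neighbour of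
  \<open>F\<close>. So the neighbours of \<open>F\<close> represent every component off
  \<open>F\<close>.\<close>

lemma reach_from_boundary:
  assumes F: "finite F" "\<one> \<in> F" and g: "g \<in> carrier G - F"
  shows "\<exists>a\<in>(\<Union>f\<in>F. (\<otimes>) f ` letters) - F. (a, g) \<in> reach G S (carrier G - F)"
proof -
  have "(\<one>, g) \<in> (cayley_adj G S \<inter> carrier G \<times> carrier G)\<^sup>*"
    using reach_one[of g] g by (simp add: reach_def)
  \<comment> \<open>The path may return to \<open>F\<close>, so the induction claim is conditional
    on the current endpoint lying outside \<open>F\<close>.\<close>
  then have "g \<notin> F \<longrightarrow> (\<exists>a\<in>(\<Union>f\<in>F. (\<otimes>) f ` letters) - F. (a, g) \<in> reach G S (carrier G - F))"
  proof (induction rule: rtrancl_induct)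
    case base
    then show ?case using F by blast
  next
    case (step y z)
    then have yz: "(y, z) \<in> cayley_adj G S" by blast
    show ?case
    proof (intro impI)
      assume z: "z \<notin> F"
      show "\<exists>a\<in>(\<Union>f\<in>F. (\<otimes>) f ` letters) - F. (a, z) \<in> reach G S (carrier G - F)"
      proof (cases "y \<in> F")
        case True
        then have "z \<in> (\<Union>f\<in>F. (\<otimes>) f ` letters)" using yz by (auto simp: cayley_adj_def)
        then show ?thesis using z by (intro bexI[of _ z]) auto
      next
        case False
        then show ?thesis
          using step.IH reach_adj[OF yz, of "carrier G - F"] adj_closed[OF yz] z by (blast intro: reach_trans)
      qed
    qed
  qed
  then show ?thesis using g by blast
qed

section \<open>Depth of the bounded components off a ball\<close>

lemma reach_off_ball:
  assumes inf: "infinite (carrier G)" and far: "far_connected G S"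
    and x: "x \<in> carrier G" "2 * n < len x" and y: "y \<in> carrier G" "2 * n < len y"
  shows "(x, y) \<in> reach G S (carrier G - vball n)"
proof -
  define A where "A = carrier G - vball n"
  obtain F' where F': "finite F'"
    "\<And>g h. g \<in> carrier G - F' \<Longrightarrow> h \<in> carrier G - F' \<Longrightarrow> (g, h) \<in> reach G S A"
    using far[unfolded far_connected_def, rule_format, OF finite_vball[of n]]
    unfolding A_def by blast
  \<comment> \<open>Adding the ball puts every vertex off \<open>F\<close> into \<open>A\<close>, so
    that \<open>FU\<close> holds by reflexivity of \<open>reach\<close>.\<close>
  define F where "F = F' \<union> vball n"
  have F: "finite F" using F' finite_vball by (simp add: F_def)
  \<comment> \<open>By the choice of \<open>F'\<close> only one component of \<open>A\<close> meets
    the complement of \<open>F\<close>; this is it.\<close>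
  define U where "U = {v \<in> A. \<exists>w\<in>carrier G - F. (v, w) \<in> reach G S A}"
  have FU: "carrier G - F \<subseteq> U"
  proof
    fix v assume "v \<in> carrier G - F"
    then show "v \<in> U"
      unfolding U_def by (intro CollectI conjI bexI[of _ v]) (auto simp: F_def A_def)
  qed
  have UC: "U \<subseteq> carrier G" by (auto simp: U_def A_def)
  have Ureach: "(u, v) \<in> reach G S A" if uv: "u \<in> U" "v \<in> U" for u v
  proof -
    obtain a where a: "a \<in> carrier G - F'" "(u, a) \<in> reach G S A" using uv unfolding U_def F_def by blast
    obtain b where b: "b \<in> carrier G - F'" "(v, b) \<in> reach G S A" using uv unfolding U_def F_def by blast
    show ?thesis using reach_trans[OF reach_trans[OF a(2) F'(2)[OF a(1) b(1)]] reach_sym[OF b(2)]] .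
  qed
  have Uclosed: "v \<in> U" if u: "u \<in> U" and uv: "(u, v) \<in> reach G S A" for u v
  proof -
    have "v \<in> A" using reach_in[OF uv] u by (simp add: U_def)
    moreover obtain w where "w \<in> carrier G - F" "(u, w) \<in> reach G S A" using u unfolding U_def by blast
    ultimately show ?thesis using reach_trans[OF reach_sym[OF uv]] unfolding U_def by blast
  qed
  have Uconf: "(u, v) \<in> reach G S U" if "u \<in> U" "v \<in> U" for u v
    by (rule reach_mono[OF _ reach_confined[OF Ureach[OF that]]]) (use Uclosed[OF that(1)] in blast)
  define T where "T = carrier G - U"
  have finT: "finite T" using FU F unfolding T_def by (elim rev_finite_subset) blast
  have oneT: "\<one> \<in> T" using len_one by (auto simp: T_def U_def A_def vball_def)
  have main: "x \<in> U" if x: "x \<in> carrier G" "2 * n < len x" for x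
  proof (rule ccontr)
    assume xU: "x \<notin> U"
    \<comment> \<open>The factor 2 enters here: \<open>len (x \<otimes> z)\<close> is at least
      \<open>len x - len z\<close>, which exceeds \<open>2 * n - n\<close>.\<close>
    have xA: "x \<otimes> z \<in> A" if "z \<in> vball n" for z
      using len_mult_ge[of x z] x that by (auto simp: A_def vball_def)
    \<comment> \<open>The translated ball is connected inside \<open>A\<close> and contains
      \<open>x\<close>; if it met \<open>U\<close>, then \<open>x\<close> would lie in
      \<open>U\<close>.\<close>
    have xB: "x \<otimes> z \<notin> U" if z: "z \<in> vball n" for z
    proof
      assume "x \<otimes> z \<in> U"
      have "(x \<otimes> \<one>, x \<otimes> z) \<in> reach G S A"
        by (rule reach_translate[OF reach_one_vball[OF z] x(1)]) (rule xA)
      then have "(x \<otimes> z, x) \<in> reach G S A" using x by (simp add: reach_sym)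
      then show False using xU Uclosed \<open>x \<otimes> z \<in> U\<close> by blast
    qed
    have off: "inv x \<otimes> v \<in> A" if "v \<in> U \<union> vball n" for v
    proof -
      have v: "v \<in> carrier G" using that UC by (auto simp: vball_def)
      have "inv x \<otimes> v \<notin> vball n"
      proof
        assume "inv x \<otimes> v \<in> vball n"
        from xB[OF this] xA[OF this] have "v \<notin> U" "v \<in> A"
          using v x by (simp_all add: m_assoc[symmetric])
        then show False using that by (simp add: A_def)
      qed
      then show ?thesis using v x by (simp add: A_def)
    qed
    \<comment> \<open>A geodesic from \<open>w\<close> back to \<open>\<one>\<close> stays in
      \<open>U\<close> until it enters the ball, because up to then it is a path in \<open>A\<close>
      starting in \<open>U\<close>.\<close>
    have one: "(\<one>, w) \<in> reach G S (U \<union> vball n)" if "w \<in> U" for w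
      using that
    proof (induction "len w" arbitrary: w)
      case 0
      then show ?case by (auto simp: U_def A_def vball_def)
    next
      case (Suc m)
      then have w: "w \<in> carrier G" "w \<in> A" using UC by (auto simp: U_def)
      obtain h where h: "(h, w) \<in> cayley_adj G S" "len h = m"
        using len_predecessor[OF w(1)] Suc(2) by metis
      have hc: "h \<in> carrier G" using adj_closed[OF h(1)] by blast
      show ?case
      proof (cases "h \<in> vball n")
        case True
        have "(\<one>, h) \<in> reach G S (U \<union> vball n)"
          by (rule reach_mono[OF _ reach_one_vball[OF True]]) blast
        moreover have "(h, w) \<in> reach G S (U \<union> vball n)"
          by (rule reach_adj[OF h(1)]) (use True Suc.prems in blast)+
        ultimately show ?thesis by (rule reach_trans)
      next
        case False
        then have "(w, h) \<in> reach G S A" using reach_adj[OF adj_sym[OF h(1)]] w hc by (simp add: A_def)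
        then have hU: "h \<in> U" by (rule Uclosed[OF Suc.prems])
        have "(h, w) \<in> reach G S (U \<union> vball n)"
          by (rule reach_adj[OF h(1)]) (use hU Suc.prems in blast)+
        with Suc.hyps(1)[OF h(2)[symmetric] hU] show ?thesis by (rule reach_trans)
      qed
    qed
    \<comment> \<open>\<open>w\<close> avoids both \<open>F\<close> and its translate, so
      \<open>w\<close> and \<open>inv x \<otimes> w\<close> both lie off \<open>F\<close>, hence in
      \<open>U\<close>. This identifies the component that contains the translated paths.\<close>
    have "infinite (carrier G - (F \<union> (\<otimes>) x ` F))" using inf F by simp
    then have "carrier G - (F \<union> (\<otimes>) x ` F) \<noteq> {}" by (metis finite.emptyI)
    then obtain w where w: "w \<in> carrier G" "w \<notin> F" "w \<notin> (\<otimes>) x ` F" by blast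
    have wU: "w \<in> U" using w FU by blast
    have "inv x \<otimes> w \<notin> F"
    proof
      assume "inv x \<otimes> w \<in> F"
      then have "x \<otimes> (inv x \<otimes> w) \<in> (\<otimes>) x ` F" by blast
      then show False using w x by (simp add: m_assoc[symmetric])
    qed
    then have xw: "inv x \<otimes> w \<in> U" using FU w x by auto
    \<comment> \<open>The path from \<open>w\<close> to \<open>v\<close> runs inside
      \<open>U \<union> vball n\<close> and not merely in \<open>A\<close>: this set avoids the
      translate of the ball by \<open>x\<close>, so \<open>inv x\<close> carries the path into
      \<open>A\<close>. Allowing \<open>v = \<one>\<close> is what excludes \<open>\<one>\<close>
      from the translate of \<open>T\<close>.\<close>
    have pull: "inv x \<otimes> v \<in> U" if v: "v \<in> U \<union> {\<one>}" for v
    proof -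
      have "(w, v) \<in> reach G S (U \<union> vball n)"
        using v one[OF wU] Uconf[OF wU, of v] by (auto intro: reach_sym reach_mono[of U])
      then have "(inv x \<otimes> w, inv x \<otimes> v) \<in> reach G S A"
        using off x by (intro reach_translate) auto
      then show ?thesis using Uclosed xw by blast
    qed
    \<comment> \<open>If \<open>x \<otimes> t\<close> were in \<open>U\<close> or equal to
      \<open>\<one>\<close>, pulling back would put \<open>t\<close> into \<open>U\<close>.\<close>
    have "(\<otimes>) x ` T \<subseteq> T - {\<one>}"
    proof
      fix z assume "z \<in> (\<otimes>) x ` T"
      then obtain t where t: "t \<in> T" "z = x \<otimes> t" by blast
      then have tc: "t \<in> carrier G" "t \<notin> U" by (auto simp: T_def)
      then have "inv x \<otimes> z = t" using x t by (simp add: m_assoc[symmetric])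
      then show "z \<in> T - {\<one>}" using pull[of z] tc t x by (auto simp: T_def)
    qed
    moreover have "card ((\<otimes>) x ` T) = card T"
      using x by (intro card_image inj_onI) (auto simp: T_def)
    ultimately have "card T \<le> card (T - {\<one>})" using finT by (metis card_mono finite_Diff)
    then show False using card_Diff1_less[OF finT oneT] by simp
  qed
  show ?thesis using Ureach main x y by (simp add: A_def)
qed

end

section \<open>Independence of the generating set\<close>

text \<open>An \<open>S'\<close>-edge at \<open>g\<close> is replaced by an \<open>S\<close>-path in
  the translate by \<open>g\<close> of an \<open>S\<close>-ball containing all letters of
  \<open>S'\<close>. Enlarging the removed set keeps these detours away from
  \<open>F\<close>.\<close>

lemma far_connected_change_generators:
  fixes G :: "('a, 'b) monoid_scheme" and S S' :: "'a set"
  assumes "group G" and S: "finite_generating_set G S" and S': "finite_generating_set G S'"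
    and far: "far_connected G S'"
  shows "far_connected G S"
  unfolding far_connected_def
proof (intro allI impI)
  fix F :: "'a set" assume F: "finite F"
  interpret group G by fact
  interpret S: cayley_graph G S by unfold_locales fact
  interpret S': cayley_graph G S' by unfold_locales fact
  obtain N where N: "\<And>s. s \<in> S'.letters \<Longrightarrow> S.len s \<le> N"
    using S'.finite_letters finite_nat_set_iff_bounded_le[of "S.len ` S'.letters"] by auto
  \<comment> \<open>\<open>F2\<close> contains every group element \<open>g\<close> with
    \<open>g \<otimes> p\<close> in \<open>F\<close> for some \<open>p\<close> in the ball, so a
    detour starting outside \<open>F2\<close> never meets \<open>F\<close>.\<close>
  define F2 where "F2 = (\<lambda>(f, p). f \<otimes>\<^bsub>G\<^esub> inv\<^bsub>G\<^esub> p) ` (F \<times> S.vball N)"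
  have fin2: "finite F2" using F S.finite_vball by (simp add: F2_def)
  obtain F' where F': "finite F'"
    "\<And>g h. g \<in> carrier G - F' \<Longrightarrow> h \<in> carrier G - F' \<Longrightarrow> (g, h) \<in> reach G S' (carrier G - F2)"
    using far[unfolded far_connected_def, rule_format, OF fin2] by blast
  have S_step: "(g, h) \<in> reach G S (carrier G - F)"
    if gh: "(g, h) \<in> cayley_adj G S'" "g \<notin> F2" for g h
  proof -
    obtain s where s: "g \<in> carrier G" "s \<in> S'.letters" "h = g \<otimes>\<^bsub>G\<^esub> s"
      using gh(1) by (auto simp: cayley_adj_def)
    have sc: "s \<in> carrier G" by (rule S'.letters_closed[OF s(2)])
    then have "s \<in> S.vball N" using N[OF s(2)] by (simp add: S.vball_def)
    have "(g \<otimes>\<^bsub>G\<^esub> \<one>\<^bsub>G\<^esub>, g \<otimes>\<^bsub>G\<^esub> s) \<in> reach G S (carrier G - F)"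
    proof (rule S.reach_translate[OF S.reach_one_vball[OF \<open>s \<in> S.vball N\<close>] s(1)])
      fix p assume p: "p \<in> S.vball N" "p \<in> carrier G"
      have "g \<otimes>\<^bsub>G\<^esub> p \<notin> F"
      proof
        assume "g \<otimes>\<^bsub>G\<^esub> p \<in> F"
        then have "(g \<otimes>\<^bsub>G\<^esub> p) \<otimes>\<^bsub>G\<^esub> inv\<^bsub>G\<^esub> p \<in> F2" unfolding F2_def using p by force
        then show False using gh(2) s(1) p by (simp add: m_assoc)
      qed
      then show "g \<otimes>\<^bsub>G\<^esub> p \<in> carrier G - F" using s p by simp
    qed
    then show ?thesis using s by simp
  qed
  have "(g, h) \<in> reach G S (carrier G - F)" if "(g, h) \<in> reach G S' (carrier G - F2)" for g h
    using that unfolding reach_def[of G S']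
  proof (induction rule: rtrancl_induct)
    case base
    show ?case by simp
  next
    case (step y z)
    then have "(y, z) \<in> reach G S (carrier G - F)" by (intro S_step) auto
    with step.IH show ?case by (rule reach_trans)
  qed
  with F' show "\<exists>F'. finite F' \<and>
      (\<forall>g\<in>carrier G - F'. \<forall>h\<in>carrier G - F'. (g, h) \<in> reach G S (carrier G - F))" by blast
qed

section \<open>Paths, open sets and compact sets in the geometric realization\<close>

lemma joined_in_iff_path_component:
  "joined_in M d A x y \<longleftrightarrow> path_component_of (subtopology (Metric_space.mtopology M d) A) x y"
  by (simp add: joined_in_def path_component_of_def)

text \<open>Affine interpolation in barycentric coordinates; it stays in the graph when
  \<open>p\<close> and \<open>q\<close> have a common simplex.\<close>

definition segment :: "('a \<Rightarrow> real) \<Rightarrow> ('a \<Rightarrow> real) \<Rightarrow> real \<Rightarrow> 'a \<Rightarrow> real" where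
  "segment p q t = (\<lambda>v. (1 - t) * p v + t * q v)"

context cayley_graph
begin

abbreviation X where "X \<equiv> cayley_points G S"

abbreviation d where "d \<equiv> cayley_dist G S"

abbreviation vertex where "vertex \<equiv> cayley_vertex :: 'a \<Rightarrow> 'a \<Rightarrow> real"

sublocale cg: Metric_space X d
  by (rule cayley_metric[OF is_group gen])

lemmas coord_nonneg = point_nonneg[OF is_group gen]
  and coord_le_1 = point_le_1[OF is_group gen]
  and coord_sum = point_sum[OF is_group gen]
  and coord_two = point_two[OF is_group gen]
  and supp_nonempty = point_nonempty[OF is_group gen]
  and supp_carrier = point_carrier[OF is_group gen]
  and vertex_in_X = vertex_point[OF is_group gen]

lemma supp_vertex': "supp (vertex g) = {g}"
  by (rule supp_vertex[OF is_group gen])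

lemma simplex_adj:
  assumes "\<sigma> \<in> cayley_simplices G S" "u \<in> \<sigma>" "v \<in> \<sigma>" "u \<noteq> v"
  shows "(u, v) \<in> cayley_adj G S"
proof -
  obtain g s where gs: "\<sigma> = {g, g \<otimes> s}" "g \<in> carrier G" "s \<in> S"
    using assms by (auto simp: cayley_simplices_def cayley_edges_def)
  then have "(g, g \<otimes> s) \<in> cayley_adj G S" unfolding cayley_adj_def by blast
  then show ?thesis using assms gs adj_sym by blast
qed

lemma adj_simplex:
  assumes "(u, v) \<in> cayley_adj G S"
  shows "{u, v} \<in> cayley_simplices G S"
proof -
  \<comment> \<open>For \<open>s = \<one>\<close> the pair collapses to a vertex, which is also a
    simplex.\<close>
  have edge: "{g, g \<otimes> s} \<in> cayley_simplices G S" if "g \<in> carrier G" "s \<in> S" for g s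
    using that by (cases "s = \<one>") (auto simp: cayley_simplices_def cayley_edges_def)
  obtain s where s: "u \<in> carrier G" "v = u \<otimes> s" "s \<in> letters"
    using assms by (auto simp: cayley_adj_def)
  show ?thesis
  proof (cases "s \<in> S")
    case True
    then show ?thesis using edge s by simp
  next
    case False
    \<comment> \<open>An inverse letter traverses an edge of \<open>S\<close> backwards, so the edge
      is read from \<open>v\<close>.\<close>
    then obtain t where t: "t \<in> S" "s = inv t" using s by blast
    then have "u = v \<otimes> t" "v \<in> carrier G"
      using s letters_closed[of t] by (simp_all add: m_assoc)
    then show ?thesis using edge[of v t] t by (simp add: insert_commute)
  qed
qed

text \<open>Off a common simplex, a shortest route leaves through some \<open>a\<close> at cost
  \<open>1 - p a\<close>, which bounds \<open>p u\<close> if \<open>u \<noteq> a\<close>, as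
  coordinates sum to 1. If \<open>u = a\<close>, either the final cost \<open>1 - q b\<close> or a
  word distance of at least 1 suffices.\<close>

lemma coordinate_Lipschitz_le:
  assumes p: "p \<in> X" and q: "q \<in> X"
  shows "p u - q u \<le> d p q"
proof (cases "share_simplex G S p q")
  case True
  show ?thesis
  proof (cases "u \<in> supp p \<union> supp q")
    case u: True
    show ?thesis using cayley_dist_common[OF is_group gen p q True u] by simp
  qed (simp add: supp_def)
next
  case False
  obtain a b where ab: "a \<in> supp p" "b \<in> supp q" "d p q = route_length G S p q a b"
    by (rule cayley_dist_route[OF is_group gen p q False])
  have le: "p a \<le> 1" "q b \<le> 1" "0 \<le> q u" "0 \<le> p u" "p u \<le> 1" using p q by (auto intro: coord_nonneg coord_le_1)
  consider "u = a" "u = b" | "u = a" "u \<noteq> b" | "u \<noteq> a" by blast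
  then show ?thesis
  proof cases
    case 1
    then show ?thesis using ab le by (simp add: route_length_def)
  next
    case 2
    then have "a \<noteq> b" "a \<in> carrier G" "b \<in> carrier G" using ab supp_carrier p q by auto
    then have "1 \<le> word_dist G S a b" using word_dist_eq_0[OF is_group gen, of a b] by simp
    then show ?thesis using ab le by (simp add: route_length_def)
  next
    case 3
    have "p u \<le> 1 - p a"
    proof (cases "p u = 0")
      case False
      then show ?thesis using coord_two[OF p, of u a] 3 ab by (simp add: supp_def)
    qed (use le in simp)
    then show ?thesis using ab le by (simp add: route_length_def)
  qed
qed

text \<open>A union of open stars of vertices. Coordinates are 1-Lipschitz, so coordinate
  \<open>u\<close> stays positive on the ball of radius \<open>p u\<close>.\<close>

lemma openin_coordinate_pos: "openin cg.mtopology {p \<in> X. \<exists>u\<in>C. 0 < p u}"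
  unfolding cg.openin_mtopology
proof (intro conjI allI impI)
  fix p assume "p \<in> {p \<in> X. \<exists>u\<in>C. 0 < p u}"
  then obtain u where u: "p \<in> X" "u \<in> C" "0 < p u" by blast
  have "cg.mball p (p u) \<subseteq> {p \<in> X. \<exists>u\<in>C. 0 < p u}"
  proof
    fix q assume "q \<in> cg.mball p (p u)"
    then have "q \<in> X" "d p q < p u" by auto
    then show "q \<in> {p \<in> X. \<exists>u\<in>C. 0 < p u}"
      using coordinate_Lipschitz_le[OF u(1), of q u] u by (auto intro!: bexI[of _ u])
  qed
  then show "\<exists>r>0. cg.mball p r \<subseteq> {p \<in> X. \<exists>u\<in>C. 0 < p u}" using u by blast
qed blast

lemma supp_segment: "supp (segment p q t) \<subseteq> supp p \<union> supp q"
  by (auto simp: supp_def segment_def)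

lemma segment_point:
  assumes \<sigma>: "\<sigma> \<in> cayley_simplices G S" "supp p \<union> supp q \<subseteq> \<sigma>" and p: "p \<in> X" and q: "q \<in> X"
    and t: "t \<in> {0..1}"
  shows "segment p q t \<in> X"
proof -
  have fin: "finite \<sigma>" by (rule simplex_finite[OF is_group gen \<sigma>(1)])
  have "(\<Sum>v\<in>\<sigma>. segment p q t v) = (1 - t) * sum p \<sigma> + t * sum q \<sigma>"
    by (simp add: segment_def sum.distrib sum_distrib_left)
  also have "\<dots> = 1" using coord_sum p q fin \<sigma>(2) by simp
  finally have "(\<Sum>v\<in>\<sigma>. segment p q t v) = 1" .
  moreover have "0 \<le> segment p q t v" for v
    using t coord_nonneg[OF p, of v] coord_nonneg[OF q, of v] by (simp add: segment_def)
  moreover have "segment p q t v = 0" if "v \<notin> \<sigma>" for v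
  proof -
    have "v \<notin> supp p" "v \<notin> supp q" using that \<sigma>(2) by blast+
    then show ?thesis by (simp add: segment_def supp_def)
  qed
  ultimately show ?thesis unfolding cayley_points_def using \<sigma>(1) by blast
qed

text \<open>Both points lie on one simplex, so their distance is the difference of a single
  coordinate, which is affine in the parameter with slope at most 1 in absolute value.\<close>

lemma segment_dist_le:
  assumes \<sigma>: "\<sigma> \<in> cayley_simplices G S" "supp p \<union> supp q \<subseteq> \<sigma>" and p: "p \<in> X" and q: "q \<in> X"
    and s: "s \<in> {0..1}" and t: "t \<in> {0..1}"
  shows "d (segment p q s) (segment p q t) \<le> \<bar>s - t\<bar>"
proof -
  note X = segment_point[OF \<sigma> p q s] segment_point[OF \<sigma> p q t]
  have sh: "share_simplex G S (segment p q s) (segment p q t)"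
    unfolding share_simplex_def using \<sigma> supp_segment[of p q s] supp_segment[of p q t] by blast
  obtain u where "u \<in> supp (segment p q s)" using supp_nonempty[OF X(1)] by blast
  then have "d (segment p q s) (segment p q t) = \<bar>segment p q s u - segment p q t u\<bar>"
    by (intro cayley_dist_common[OF is_group gen X sh]) simp
  also have "\<dots> = \<bar>(s - t) * (q u - p u)\<bar>" by (simp add: segment_def algebra_simps)
  also have "\<dots> = \<bar>s - t\<bar> * \<bar>q u - p u\<bar>" by (rule abs_mult)
  also have "\<dots> \<le> \<bar>s - t\<bar> * 1"
    using coord_nonneg[OF p, of u] coord_le_1[OF p, of u] coord_nonneg[OF q, of u] coord_le_1[OF q, of u] by (intro mult_left_mono) auto
  finally show ?thesis by simp
qed

lemma pathin_segment:
  assumes \<sigma>: "\<sigma> \<in> cayley_simplices G S" "supp p \<union> supp q \<subseteq> \<sigma>" and p: "p \<in> X" and q: "q \<in> X"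
  shows "pathin cg.mtopology (segment p q)"
  unfolding pathin_def cg.continuous_map_to_metric
proof (intro ballI allI impI)
  fix t \<epsilon> :: real assume "t \<in> topspace (top_of_set {0..1})" "0 < \<epsilon>"
  then have t: "t \<in> {0..1}" by simp
  have "segment p q s \<in> cg.mball (segment p q t) \<epsilon>" if "s \<in> {0..1} \<inter> ball t \<epsilon>" for s
  proof -
    have "d (segment p q t) (segment p q s) \<le> \<bar>t - s\<bar>"
      using that by (intro segment_dist_le[OF \<sigma> p q t]) auto
    moreover have "\<bar>t - s\<bar> < \<epsilon>" using that by (simp add: dist_real_def)
    ultimately show ?thesis using that t segment_point[OF \<sigma> p q] by auto
  qed
  moreover have "openin (top_of_set {0..1}) ({0..1} \<inter> ball t \<epsilon>)" by (simp add: openin_open_Int)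
  ultimately show "\<exists>U. openin (top_of_set {0..1}) U \<and> t \<in> U
      \<and> (\<forall>s\<in>U. segment p q s \<in> cg.mball (segment p q t) \<epsilon>)"
    using t \<open>0 < \<epsilon>\<close> by (intro exI[of _ "{0..1} \<inter> ball t \<epsilon>"]) auto
qed

lemma path_component_of_segment:
  assumes \<sigma>: "\<sigma> \<in> cayley_simplices G S" "supp p \<union> supp q \<subseteq> \<sigma>" and p: "p \<in> X" and q: "q \<in> X"
    and A: "\<And>r. r \<in> X \<Longrightarrow> supp r \<subseteq> supp p \<union> supp q \<Longrightarrow> r \<in> A"
  shows "path_component_of (subtopology cg.mtopology A) p q"
  unfolding path_component_of_def
proof (intro exI conjI)
  show "pathin (subtopology cg.mtopology A) (segment p q)"
    unfolding pathin_subtopology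
    by (intro conjI ballI pathin_segment[OF \<sigma> p q] A segment_point[OF \<sigma> p q] supp_segment)
qed (auto simp: segment_def)

text \<open>Each edge of the combinatorial path is realized by a segment whose points are supported
  in \<open>B\<close>. As \<open>reach\<close> is reflexive also off \<open>B\<close>, the start has
  to be assumed in \<open>B\<close>.\<close>

lemma path_component_of_reach:
  assumes "(g, h) \<in> reach G S B" and g: "g \<in> carrier G" "g \<in> B"
    and A: "\<And>r. r \<in> X \<Longrightarrow> supp r \<subseteq> B \<Longrightarrow> r \<in> A"
  shows "path_component_of (subtopology cg.mtopology A) (vertex g) (vertex h)"
  using assms(1) unfolding reach_def
proof (induction rule: rtrancl_induct)
  case base
  have "vertex g \<in> A" using A vertex_in_X g supp_vertex' by simp
  then show ?case using vertex_in_X g by (simp add: path_component_of_refl)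
next
  case (step y z)
  then have yz: "(y, z) \<in> cayley_adj G S" "y \<in> B" "z \<in> B" by auto
  have "path_component_of (subtopology cg.mtopology A) (vertex y) (vertex z)"
    using adj_simplex[OF yz(1)] adj_closed[OF yz(1)] yz
    by (intro path_component_of_segment[of "{y, z}"])
       (auto simp: supp_vertex' vertex_in_X intro!: A)
  with step.IH show ?case by (rule path_component_of_trans)
qed

lemma compactin_full_subcomplex:
  assumes "finite F"
  shows "compactin cg.mtopology {p \<in> X. supp p \<subseteq> F}"
proof -
  \<comment> \<open>The full subcomplex is a finite union of segments; pairs \<open>(g, g)\<close>
    are kept so that vertices are covered by constant segments.\<close>
  define E where "E = {(g, h). g \<in> F \<and> h \<in> F \<and> {g, h} \<in> cayley_simplices G S}"
  have finE: "finite E" by (rule finite_subset[of _ "F \<times> F"]) (auto simp: E_def assms)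
  have vx: "vertex g \<in> X" "vertex h \<in> X" if "(g, h) \<in> E" for g h
  proof -
    have "{g, h} \<in> cayley_simplices G S" using that by (simp add: E_def)
    then have "{g, h} \<subseteq> carrier G" by (rule simplex_cases[OF is_group gen]) auto
    then show "vertex g \<in> X" "vertex h \<in> X" using vertex_in_X by auto
  qed
  have eq: "{p \<in> X. supp p \<subseteq> F} = (\<Union>(g, h)\<in>E. segment (vertex g) (vertex h) ` {0..1})"
  proof (intro equalityI subsetI)
    fix p assume "p \<in> {p \<in> X. supp p \<subseteq> F}"
    then have p: "p \<in> X" "supp p \<subseteq> F" by auto
    obtain \<sigma> where \<sigma>: "\<sigma> \<in> cayley_simplices G S" "supp p \<subseteq> \<sigma>" by (rule point_simplex[OF is_group gen p(1)])
    obtain u where u: "u \<in> supp p" using supp_nonempty[OF p(1)] by blast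
    have "\<exists>(g, h)\<in>E. p \<in> segment (vertex g) (vertex h) ` {0..1}"
    proof (cases "supp p = {u}")
      case True
      then have "p u = 1" using coord_sum[OF p(1), of "{u}"] by simp
      moreover have "p w = 0" if "w \<noteq> u" for w using True that by (auto simp: supp_def)
      ultimately have "p = vertex u" by (auto simp: cayley_vertex_def fun_eq_iff)
      then have "p = segment (vertex u) (vertex u) 0" by (simp add: segment_def)
      moreover have "(u, u) \<in> E"
        using u p supp_carrier[OF p(1)] by (auto simp: E_def cayley_simplices_def)
      ultimately show ?thesis by (intro bexI[of _ "(u, u)"]) auto
    next
      case False
      then obtain v where v: "v \<in> supp p" "v \<noteq> u" using u by blast
      obtain a b where "\<sigma> = {a, b}" using simplex_pair[OF is_group gen \<sigma>(1)] by blast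
      then have suv: "\<sigma> = {u, v}" using \<sigma>(2) u v by auto
      have "p u + p v = 1" using coord_two[OF p(1) u v(1)] v by simp
      moreover have "p w = 0" if "w \<noteq> u" "w \<noteq> v" for w using that \<sigma>(2) suv by (auto simp: supp_def)
      ultimately have "p = segment (vertex u) (vertex v) (p v)"
        using v by (auto simp: segment_def cayley_vertex_def fun_eq_iff)
      moreover have "(u, v) \<in> E" using u v p \<sigma> suv by (auto simp: E_def)
      moreover have "p v \<in> {0..1}" using coord_nonneg[OF p(1)] coord_le_1[OF p(1)] by simp
      ultimately show ?thesis by (intro bexI[of _ "(u, v)"]) blast+
    qed
    then show "p \<in> (\<Union>(g, h)\<in>E. segment (vertex g) (vertex h) ` {0..1})" by blast
  next
    fix p assume "p \<in> (\<Union>(g, h)\<in>E. segment (vertex g) (vertex h) ` {0..1})"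
    then obtain g h t where gh: "(g, h) \<in> E" "t \<in> {0..1}" "p = segment (vertex g) (vertex h) t" by blast
    then have "p \<in> X"
      using vx[OF gh(1)] by (auto simp: E_def supp_vertex' intro!: segment_point[of "{g, h}"])
    moreover have "supp p \<subseteq> F"
      using supp_segment[of "vertex g" "vertex h" t] gh by (auto simp: supp_vertex' E_def)
    ultimately show "p \<in> {p \<in> X. supp p \<subseteq> F}" by blast
  qed
  have "compactin cg.mtopology (segment (vertex g) (vertex h) ` {0..1})" if "(g, h) \<in> E" for g h
    by (intro compactin_path_image pathin_segment[of "{g, h}"])
       (use that vx[OF that] in \<open>auto simp: E_def supp_vertex'\<close>)
  then show ?thesis unfolding eq using finE by (intro compactin_Union) auto
qed

section \<open>Distance to the identity versus word length\<close>

lemma dist_vertex: "g \<in> carrier G \<Longrightarrow> h \<in> carrier G \<Longrightarrow> d (vertex g) (vertex h) = real (word_dist G S g h)"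
  by (rule cayley_dist_vertex[OF is_group gen])

lemma dist_one_vertex: "g \<in> carrier G \<Longrightarrow> d (vertex \<one>) (vertex g) = real (len g)"
  by (simp add: dist_vertex word_dist_def)

lemma dist_vertex_supp:
  assumes "p \<in> X" "u \<in> supp p"
  shows "d (vertex u) p \<le> 1"
proof -
  have u: "u \<in> carrier G" using assms supp_carrier by blast
  have "share_simplex G S (vertex u) p"
    unfolding share_simplex_def supp_vertex'
    by (rule point_simplex[OF is_group gen assms(1)]) (use assms(2) in blast)
  then have "d (vertex u) p = \<bar>vertex u u - p u\<bar>"
    using assms by (intro cayley_dist_common[OF is_group gen vertex_in_X[OF u]]) auto
  then show ?thesis using coord_nonneg[OF assms(1), of u] coord_le_1[OF assms(1), of u] by (simp add: cayley_vertex_def)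
qed

text \<open>A supporting vertex is within 1 of \<open>p\<close>. This error feeds the additive
  constant in the upper bound for the end depth.\<close>

lemma dist_one_supp:
  assumes p: "p \<in> X" "u \<in> supp p"
  shows "\<bar>d (vertex \<one>) p - real (len u)\<bar> \<le> 1"
proof -
  have u: "u \<in> carrier G" using p supp_carrier by blast
  have "d (vertex \<one>) p \<le> d (vertex \<one>) (vertex u) + d (vertex u) p"
    "d (vertex \<one>) (vertex u) \<le> d (vertex \<one>) p + d p (vertex u)"
    using cg.triangle vertex_in_X u p by blast+
  then show ?thesis using dist_vertex_supp[OF p] dist_one_vertex[OF u] cg.commute[of p "vertex u"] by linarith
qed

section \<open>Consequences of having one end\<close>

text \<open>The Cayley graph of a finite group is bounded, so no component off any set is unbounded
  and the number of ends is 0.\<close>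

lemma infinite_carrier:
  assumes "number_of_ends X d = 1"
  shows "infinite (carrier G)"
proof
  assume fin: "finite (carrier G)"
  have "X \<subseteq> cg.mcball (vertex \<one>) (real (Max (len ` carrier G)) + 1)"
  proof
    fix p assume p: "p \<in> X"
    then obtain u where u: "u \<in> supp p" using supp_nonempty by blast
    then have "len u \<le> Max (len ` carrier G)" using fin supp_carrier[OF p] by (intro Max_ge) auto
    then show "p \<in> cg.mcball (vertex \<one>) (real (Max (len ` carrier G)) + 1)"
      using dist_one_supp[OF p u] p vertex_in_X by auto
  qed
  then have "cg.mbounded C" if "C \<subseteq> X" for C
    using that unfolding cg.mbounded_def by blast
  moreover have "C \<subseteq> X" if "C \<in> connected_components_of (subtopology cg.mtopology (X - K))" for C K
    using connected_components_of_subset[OF that] by auto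
  ultimately have "unbounded_components X d K = {}" for K
    unfolding unbounded_components_def by blast
  then have "ends_off X d K = 0" for K by (simp add: ends_off_def zero_enat_def)
  then have "number_of_ends X d \<le> 0" unfolding number_of_ends_def by (intro SUP_least) simp
  then show False using assms by simp
qed

text \<open>
  The compact set removed is the full subcomplex on \<open>F\<close> rather than a metric ball: a point off it has a
  vertex of its support outside \<open>F\<close>, and the combinatorial component of that vertex does not depend on
  the choice.  So combinatorial components split the complement into disjoint open sets.
\<close>

lemma far_connected_one_end:
  assumes ends: "number_of_ends X d = 1"
  shows "far_connected G S"
  unfolding far_connected_def
proof (intro allI impI)
  fix F0 :: "'a set" assume "finite F0"
  \<comment> \<open>\<open>\<one>\<close> is added as the starting point that
    \<open>reach_from_boundary\<close> needs.\<close>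
  define F where "F = insert \<one> F0"
  have F: "finite F" "\<one> \<in> F" using \<open>finite F0\<close> by (simp_all add: F_def)
  define W where "W = carrier G - F"
  define comp where "comp g = {h. (g, h) \<in> reach G S W}" for g
  define N where "N = (\<Union>f\<in>F. (\<otimes>) f ` letters) - F"
  have "finite N" using F finite_letters unfolding N_def by blast
  \<comment> \<open>Every component off \<open>F\<close> has a representative in the finite set
    \<open>N\<close>, so discarding all finite components discards only finitely many
    vertices.\<close>
  define F' where "F' = F \<union> \<Union>(comp ` {a \<in> N. finite (comp a)})"
  have finF': "finite F'" using \<open>finite N\<close> F by (auto simp: F'_def)
  have inf: "infinite (comp g)" if g: "g \<in> carrier G - F'" for g
  proof
    assume fin: "finite (comp g)"
    have "g \<in> carrier G - F" using g by (simp add: F'_def)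
    from reach_from_boundary[OF F this]
    obtain a where a: "a \<in> N" "(a, g) \<in> reach G S W" unfolding N_def W_def by blast
    have "comp a \<subseteq> comp g"
      unfolding comp_def using reach_trans[OF reach_sym[OF a(2)]] by blast
    then have "finite (comp a)" using fin by (rule finite_subset)
    then have "g \<in> F'" unfolding F'_def using a by (auto simp: comp_def)
    then show False using g by blast
  qed
  define K where "K = {p \<in> X. supp p \<subseteq> F}"
  define Y where "Y = subtopology cg.mtopology (X - K)"
  have offK: "r \<in> X - K" if "r \<in> X" "supp r \<subseteq> W" for r
    using that supp_nonempty[OF that(1)] by (auto simp: K_def W_def)
  \<comment> \<open>The vertices of an infinite combinatorial component lie in one path component;
    if that were bounded, they would all lie in a finite ball.\<close>
  have unb: "connected_component_of_set Y (vertex g) \<in> unbounded_components X d K"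
    if g: "g \<in> carrier G - F'" for g
  proof -
    have gW: "g \<in> carrier G" "g \<in> W" using g by (auto simp: F'_def W_def)
    then have "vertex g \<in> topspace Y"
      using offK[of "vertex g"] vertex_in_X by (simp add: Y_def supp_vertex')
    then have "connected_component_of_set Y (vertex g) \<in> connected_components_of Y"
      by (simp add: connected_component_in_connected_components_of)
    moreover have "\<not> cg.mbounded (connected_component_of_set Y (vertex g))"
    proof
      assume "cg.mbounded (connected_component_of_set Y (vertex g))"
      then obtain B where B: "\<And>p q. p \<in> connected_component_of_set Y (vertex g) \<Longrightarrow>
          q \<in> connected_component_of_set Y (vertex g) \<Longrightarrow> d p q \<le> B"
        unfolding cg.mbounded_alt by blast
      have "comp g \<subseteq> vball (len g + nat \<lceil>B\<rceil>)"
      proof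
        fix h assume "h \<in> comp g"
        then have gh: "(g, h) \<in> reach G S W" by (simp add: comp_def)
        have hc: "h \<in> carrier G" using reach_in[OF gh gW(2)] by (simp add: W_def)
        have "path_component_of Y (vertex g) (vertex h)"
          unfolding Y_def by (rule path_component_of_reach[OF gh gW offK])
        then have "connected_component_of Y (vertex g) (vertex h)"
          by (rule path_imp_connected_component_of)
        then have "d (vertex g) (vertex h) \<le> B"
          using \<open>vertex g \<in> topspace Y\<close> by (intro B) (auto simp: connected_component_of_refl)
        then have "real (word_dist G S g h) \<le> B" using dist_vertex gW hc by simp
        moreover have "len h \<le> len g + word_dist G S g h"
          using word_dist_triangle[OF is_group gen, of \<one> g h] gW hc by (simp add: word_dist_def)
        ultimately show "h \<in> vball (len g + nat \<lceil>B\<rceil>)" using hc by (simp add: vball_def) linarith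
      qed
      then show False using inf[OF g] finite_vball finite_subset by blast
    qed
    ultimately show ?thesis by (simp add: unbounded_components_def Y_def)
  qed
  have "compactin cg.mtopology K" unfolding K_def by (rule compactin_full_subcomplex[OF F(1)])
  \<comment> \<open>The supremum bounds this single \<open>K\<close>: the unbounded components of
    \<open>vertex g\<close> and \<open>vertex h\<close> must coincide.\<close>
  then have "ends_off X d K \<le> 1"
    unfolding ends[symmetric] number_of_ends_def by (intro SUP_upper) simp
  then have card: "finite (unbounded_components X d K)" "card (unbounded_components X d K) \<le> 1"
    by (auto simp: ends_off_def one_enat_def split: if_splits)
  have "(g, h) \<in> reach G S W" if g: "g \<in> carrier G - F'" and h: "h \<in> carrier G - F'" for g h
  proof (rule ccontr)
    assume ngh: "(g, h) \<notin> reach G S W"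
    have hW: "h \<in> W" "h \<in> carrier G" "g \<in> carrier G" using g h by (auto simp: F'_def W_def)
    have "connected_component_of_set Y (vertex g) = connected_component_of_set Y (vertex h)"
      using card(2) unb[OF g] unb[OF h] card_le_Suc0_iff_eq[OF card(1)] by simp
    moreover have "connected_component_of Y (vertex h) (vertex h)"
      using offK[of "vertex h"] vertex_in_X hW by (simp add: Y_def supp_vertex' connected_component_of_refl)
    ultimately have "connected_component_of Y (vertex g) (vertex h)" by blast
    then obtain T where "connectedin Y T" and gT: "vertex g \<in> T" and hT: "vertex h \<in> T"
      by (auto simp: connected_component_of_def)
    then have T: "connectedin cg.mtopology T" "T \<subseteq> X - K"
      by (auto simp: Y_def connectedin_subtopology)
    \<comment> \<open>\<open>O2\<close> collects all other combinatorial components, so the two open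
      sets cover the complement of \<open>K\<close> and would separate \<open>T\<close>.\<close>
    define O1 where "O1 = {p \<in> X. \<exists>u\<in>comp g. 0 < p u}"
    define O2 where "O2 = {p \<in> X. \<exists>u\<in>W - comp g. 0 < p u}"
    have "T \<subseteq> O1 \<union> O2"
    proof
      fix p assume "p \<in> T"
      then have p: "p \<in> X" "\<not> supp p \<subseteq> F" using T(2) by (auto simp: K_def)
      then obtain u where u: "u \<in> supp p" "u \<in> W" using supp_carrier[OF p(1)] by (auto simp: W_def)
      have "0 < p u" using u coord_nonneg[OF p(1), of u] by (simp add: supp_def)
      then show "p \<in> O1 \<union> O2" using u p by (auto simp: O1_def O2_def)
    qed
    moreover have "O1 \<inter> O2 \<inter> T = {}"
    proof -
      have False if p: "p \<in> X" and u: "u \<in> comp g" "0 < p u" and v: "v \<in> W" "v \<notin> comp g" "0 < p v" for p u v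
      proof -
        obtain \<sigma> where \<sigma>: "\<sigma> \<in> cayley_simplices G S" "supp p \<subseteq> \<sigma>" by (rule point_simplex[OF is_group gen p])
        have gu: "(g, u) \<in> reach G S W" using u by (simp add: comp_def)
        then have "u \<in> W" using reach_in[OF gu] g by (auto simp: W_def F'_def)
        moreover have "(u, v) \<in> cayley_adj G S"
          using \<sigma> u v by (intro simplex_adj[OF \<sigma>(1)]) (auto simp: supp_def)
        ultimately have "(u, v) \<in> reach G S W" using v by (intro reach_adj)
        with gu have "(g, v) \<in> reach G S W" by (rule reach_trans)
        then show False using v by (simp add: comp_def)
      qed
      then show ?thesis unfolding O1_def O2_def by blast
    qed
    moreover have "vertex g \<in> O1 \<inter> T"
      using gT hW vertex_in_X by (auto simp: O1_def cayley_vertex_def comp_def intro!: bexI[of _ g])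
    moreover have "vertex h \<in> O2 \<inter> T"
      using hT hW ngh vertex_in_X by (auto simp: O2_def cayley_vertex_def comp_def intro!: bexI[of _ h])
    moreover have "openin cg.mtopology O1" "openin cg.mtopology O2"
      unfolding O1_def O2_def by (rule openin_coordinate_pos)+
    ultimately show False using T(1) unfolding connectedin by blast
  qed
  then have "(g, h) \<in> reach G S (carrier G - F0)" if "g \<in> carrier G - F'" "h \<in> carrier G - F'" for g h
    by (rule reach_mono[rotated]) (use that in \<open>auto simp: W_def F_def\<close>)
  then show "\<exists>F'. finite F' \<and> (\<forall>g\<in>carrier G - F'. \<forall>h\<in>carrier G - F'. (g, h) \<in> reach G S (carrier G - F0))"
    using finF' by blast
qed

section \<open>Linear bounds for the end depth function\<close>

abbreviation depth_set where "depth_set \<equiv> end_depth_set X d (vertex \<one>)"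

text \<open>For smaller \<open>k\<close> a vertex of length \<open>nat \<lfloor>r\<rfloor>\<close>
  lies outside the ball of radius \<open>k\<close> but inside that of radius \<open>r\<close>, so
  outside the latter it cannot be joined even to itself.\<close>

lemma depth_set_ge:
  assumes inf: "infinite (carrier G)" and "0 < r" and k: "k \<in> depth_set r"
  shows "r - 1 \<le> k"
proof (rule ccontr)
  assume "\<not> r - 1 \<le> k"
  then have m: "k < real (nat \<lfloor>r\<rfloor>)" "real (nat \<lfloor>r\<rfloor>) \<le> r" using \<open>0 < r\<close> by linarith+
  obtain g where g: "g \<in> carrier G" "len g = nat \<lfloor>r\<rfloor>" by (rule ex_len[OF inf])
  have "vertex g \<in> X - cg.mcball (vertex \<one>) k"
    using g m vertex_in_X by (simp add: dist_one_vertex)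
  then have "path_component_of (subtopology cg.mtopology (X - cg.mcball (vertex \<one>) r)) (vertex g) (vertex g)"
    using k unfolding end_depth_set_def joined_in_iff_path_component by blast
  then have "vertex g \<notin> cg.mcball (vertex \<one>) r" by (auto simp: path_component_of_refl)
  then show False using g m vertex_in_X by (simp add: dist_one_vertex)
qed

text \<open>Each far point slides along its simplex to a vertex, and the vertices are joined by
  \<open>reach_off_ball\<close>.\<close>

lemma depth_set_mem:
  assumes inf: "infinite (carrier G)" and far: "far_connected G S" and "0 < r"
  shows "2 * r + 3 \<in> depth_set r"
proof -
  obtain m where m: "real m \<le> r" "r < real m + 1"
    using \<open>0 < r\<close> by (intro that[of "nat \<lfloor>r\<rfloor>"]) linarith+
  \<comment> \<open>A point supported off \<open>vball n\<close> has distance at least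
    \<open>n > r\<close> from \<open>\<one>\<close>, as passing from vertex to point loses at most
    1. Beyond distance \<open>2 * r + 3\<close> the same loss leaves vertices of length above
    \<open>2 * r + 2 \<ge> 2 * n\<close>.\<close>
  define n where "n = m + 1"
  have n: "r < real n" "real (2 * n + 1) \<le> 2 * r + 3" using m by (simp_all add: n_def)
  define A where "A = X - cg.mcball (vertex \<one>) r"
  have A: "p \<in> A" if p: "p \<in> X" "supp p \<subseteq> carrier G - vball n" for p
  proof -
    obtain u where u: "u \<in> supp p" using supp_nonempty[OF p(1)] by blast
    then have "n < len u" using p by (auto simp: vball_def)
    then have "real n + 1 \<le> real (len u)" by linarith
    then have "r < d (vertex \<one>) p" using dist_one_supp[OF p(1) u] n(1) by linarith
    then show ?thesis using p(1) by (simp add: A_def)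
  qed
  have enter: "\<exists>u\<in>carrier G. 2 * n < len u \<and> path_component_of (subtopology cg.mtopology A) x (vertex u)"
    if x: "x \<in> X - cg.mcball (vertex \<one>) (2 * r + 3)" for x
  proof -
    have xX: "x \<in> X" and dx: "2 * r + 3 < d (vertex \<one>) x" using x vertex_in_X by auto
    have far: "2 * n < len u" if "u \<in> supp x" for u
      using dist_one_supp[OF xX that] dx n by linarith
    obtain u where u: "u \<in> supp x" using supp_nonempty[OF xX] by blast
    obtain \<sigma> where \<sigma>: "\<sigma> \<in> cayley_simplices G S" "supp x \<subseteq> \<sigma>" by (rule point_simplex[OF is_group gen xX])
    have uc: "u \<in> carrier G" using u supp_carrier[OF xX] by blast
    have "path_component_of (subtopology cg.mtopology A) x (vertex u)"
    proof (rule path_component_of_segment[OF \<sigma>(1) _ xX vertex_in_X[OF uc]])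
      show "supp x \<union> supp (vertex u) \<subseteq> \<sigma>" using \<sigma> u by (auto simp: supp_vertex')
      fix p assume p: "p \<in> X" "supp p \<subseteq> supp x \<union> supp (vertex u)"
      have "v \<in> carrier G - vball n" if "v \<in> supp p" for v
        using p that u far[of v] supp_carrier[OF p(1)] by (auto simp: supp_vertex' vball_def)
      then show "p \<in> A" using A[OF p(1)] by blast
    qed
    then show ?thesis using uc far[OF u] by blast
  qed
  have "joined_in X d A x y"
    if x: "x \<in> X - cg.mcball (vertex \<one>) (2 * r + 3)" and y: "y \<in> X - cg.mcball (vertex \<one>) (2 * r + 3)" for x y
  proof -
    obtain u where u: "u \<in> carrier G" "2 * n < len u" "path_component_of (subtopology cg.mtopology A) x (vertex u)"
      using enter[OF x] by blast
    obtain v where v: "v \<in> carrier G" "2 * n < len v" "path_component_of (subtopology cg.mtopology A) y (vertex v)"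
      using enter[OF y] by blast
    have "path_component_of (subtopology cg.mtopology A) (vertex u) (vertex v)"
      by (rule path_component_of_reach[OF reach_off_ball[OF inf far u(1,2) v(1,2)] u(1)])
         (use u A in \<open>auto simp: vball_def\<close>)
    with u(3) v(3) show ?thesis
      unfolding joined_in_iff_path_component by (meson path_component_of_sym path_component_of_trans)
  qed
  then show ?thesis unfolding end_depth_set_def A_def by blast
qed

text \<open>The end depth lies between \<open>r - 1\<close> and \<open>2 * r + 3\<close>. The set
  defining it is nonempty and bounded below, so \<open>Inf\<close> is a genuine infimum.\<close>

lemma linear_growth_end_depth:
  assumes inf: "infinite (carrier G)" and far: "far_connected G S"
  shows "linear_growth (cayley_end_depth G S)"
proof -
  have "cayley_end_depth G S r \<le> 2 * (1 * r) + 3" if r: "0 < r" for r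
    unfolding cayley_end_depth_def using depth_set_mem[OF inf far r]
    by (intro cInf_lower bdd_belowI[of _ "r - 1"]) (auto intro: depth_set_ge[OF inf r])
  moreover have "r \<le> 1 * cayley_end_depth G S (1 * r) + 1" if r: "0 < r" for r
  proof -
    have "r - 1 \<le> cayley_end_depth G S r"
      unfolding cayley_end_depth_def using depth_set_mem[OF inf far r]
      by (intro cInf_greatest depth_set_ge[OF inf r]) auto
    then show ?thesis by simp
  qed
  ultimately show ?thesis
    unfolding linear_growth_def growth_equiv_def growth_le_def
    by (intro conjI) (rule exI[of _ 2], simp, rule exI[of _ 1], force, rule exI[of _ 1], simp, rule exI[of _ 1], force)
qed

end

theorem theorem2:
  fixes G :: "('a, 'b) monoid_scheme" and S :: "'a set"
  assumes "group G"
    and "one_ended G"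
    and "finite_generating_set G S"
  shows "linear_growth (cayley_end_depth G S)"
proof -
  interpret group G by fact
  interpret S: cayley_graph G S by unfold_locales fact
  \<comment> \<open>One-endedness supplies some \<open>S'\<close>, possibly different from
    \<open>S\<close>. Infiniteness and \<open>far_connected\<close> are obtained there; only the
    latter depends on the generators and has to be transported.\<close>
  obtain S' where S': "finite_generating_set G S'"
    "number_of_ends (cayley_points G S') (cayley_dist G S') = 1"
    using \<open>one_ended G\<close> by (auto simp: one_ended_def)
  interpret S': cayley_graph G S' by unfold_locales (rule S'(1))
  have "far_connected G S"
    using far_connected_change_generators[OF assms(1,3) S'(1) S'.far_connected_one_end[OF S'(2)]] .
  then show ?thesis by (rule S.linear_growth_end_depth[OF S'.infinite_carrier[OF S'(2)]])
qed

end
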